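(* Let $n,m\ge 1$ be integers, let $A_1,\dots,A_m$ be positive $n\times n$ complex matrices and let $Z_1,\dots,Z_m$ be expansive $n\times n$ complex matrices. Then, for all symmetric norms $\|\cdot\|$ on the $n\times n$ complex matrices and all real $p>1$, $$ \left\| \sum_{i=1}^m Z_i^*A_i^pZ_i \right\| \le \left\| \left(\sum_{i=1}^m Z_i^*A_iZ_i \right)^p \right\|. $$
   Context: "Positive" means positive semidefinite (Hermitian), written $A\ge 0$. A matrix $Z$ is called expansive if $Z^*Z\ge I$, i.e. $Z^*Z-I$ is positive semidefinite. A symmetric (or unitarily invariant) norm is a norm $\|\cdot\|$ on the space of $n\times n$ complex matrices such that $\|A\|=\|UAV\|$ for all matrices $A$ and all unitaries $U,V$. Powers of positive matrices are taken in the sense of the functional calculus. *)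

theory Defs
  imports "HOL-Analysis.Analysis"
begin

definition adjoint_mat :: "complex ^ 'n ^ 'm \<Rightarrow> complex ^ 'm ^ 'n" where
  "adjoint_mat A = map_matrix cnj (transpose A)"

(* The real part is no restriction: for Hermitian A the quadratic form x^* A x is real. *)
definition psd :: "complex ^ 'n ^ 'n \<Rightarrow> bool" where
  "psd A \<longleftrightarrow> adjoint_mat A = A \<and>
     (\<forall>x. 0 \<le> Re (\<Sum>i\<in>UNIV. cnj (x $ i) * (A *v x) $ i))"

definition expansive :: "complex ^ 'n ^ 'n \<Rightarrow> bool" where
  "expansive Z \<longleftrightarrow> psd (adjoint_mat Z ** Z - mat 1)"

definition unitary_mat :: "complex ^ 'n ^ 'n \<Rightarrow> bool" where
  "unitary_mat U \<longleftrightarrow> adjoint_mat U ** U = mat 1 \<and> U ** adjoint_mat U = mat 1"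

(* The library fixes one norm on this type (the Frobenius norm), so an arbitrary norm is
   a function N; homogeneity is over the complex scalars. *)
definition symmetric_norm :: "(complex ^ 'n ^ 'n \<Rightarrow> real) \<Rightarrow> bool" where
  "symmetric_norm N \<longleftrightarrow>
     (\<forall>A. 0 \<le> N A) \<and>
     (\<forall>A. N A = 0 \<longleftrightarrow> A = 0) \<and>
     (\<forall>c A. N (map_matrix (\<lambda>z. c * z) A) = cmod c * N A) \<and>
     (\<forall>A B. N (A + B) \<le> N A + N B) \<and>
     (\<forall>A U V. unitary_mat U \<longrightarrow> unitary_mat V \<longrightarrow> N (U ** A ** V) = N A)"

definition real_diag :: "('n \<Rightarrow> real) \<Rightarrow> complex ^ 'n ^ 'n" where
  "real_diag d = (\<chi> i j. if i = j then complex_of_real (d i) else 0)"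

(* Functional calculus of a Hermitian matrix: if A = U diag(d) U^* with U unitary, then
   f(A) = U diag(f o d) U^*.  By the lemma mat_fun_unitary_diag below, this does not depend
   on the diagonalization; for a matrix that is not Hermitian the value is unspecified. *)
definition mat_fun :: "(real \<Rightarrow> real) \<Rightarrow> complex ^ 'n ^ 'n \<Rightarrow> complex ^ 'n ^ 'n" where
  "mat_fun f A = (THE B. \<exists>U d. unitary_mat U \<and>
      A = U ** real_diag d ** adjoint_mat U \<and>
      B = U ** real_diag (\<lambda>i. f (d i)) ** adjoint_mat U)"

definition mat_powr :: "complex ^ 'n ^ 'n \<Rightarrow> real \<Rightarrow> complex ^ 'n ^ 'n" where
  "mat_powr A p = mat_fun (\<lambda>t. t powr p) A"

lemma real_diag_mult_left: "(real_diag d ** X) $ i $ j = complex_of_real (d i) * X $ i $ j"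
proof -
  have "(real_diag d ** X) $ i $ j
      = (\<Sum>k\<in>UNIV. if i = k then complex_of_real (d i) * X $ k $ j else 0)"
    unfolding matrix_matrix_mult_def real_diag_def vec_lambda_beta
    by (rule sum.cong) auto
  then show ?thesis by simp
qed

lemma real_diag_mult_right: "(X ** real_diag d) $ i $ j = X $ i $ j * complex_of_real (d j)"
proof -
  have "(X ** real_diag d) $ i $ j
      = (\<Sum>k\<in>UNIV. if k = j then X $ i $ k * complex_of_real (d j) else 0)"
    unfolding matrix_matrix_mult_def real_diag_def vec_lambda_beta
    by (rule sum.cong) auto
  then show ?thesis by simp
qed

lemma mat_fun_unique:
  fixes U V :: "complex ^ 'n ^ 'n"
  assumes U: "unitary_mat U" and V: "unitary_mat V"
    and eq: "U ** real_diag d ** adjoint_mat U = V ** real_diag e ** adjoint_mat V"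
  shows "U ** real_diag (\<lambda>i. f (d i)) ** adjoint_mat U
       = V ** real_diag (\<lambda>i. f (e i)) ** adjoint_mat V"
proof -
  define W where "W = adjoint_mat V ** U"
  have UU: "adjoint_mat U ** U = mat 1" "U ** adjoint_mat U = mat 1"
    and VV: "adjoint_mat V ** V = mat 1" "V ** adjoint_mat V = mat 1"
    using U V by (auto simp: unitary_mat_def)
  have VW: "V ** W = U"
    unfolding W_def by (simp add: matrix_mul_assoc VV)
  have WU: "W ** adjoint_mat U = adjoint_mat V"
    unfolding W_def by (simp add: matrix_mul_assoc[symmetric] UU)
  have "W ** real_diag d = adjoint_mat V ** (U ** real_diag d ** adjoint_mat U) ** U"
    unfolding W_def by (simp add: matrix_mul_assoc[symmetric] UU)
  also have "\<dots> = real_diag e ** W"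
    unfolding eq W_def by (simp add: matrix_mul_assoc VV)
  finally have comm: "W ** real_diag d = real_diag e ** W" .
  have "W ** real_diag (\<lambda>i. f (d i)) = real_diag (\<lambda>i. f (e i)) ** W"
  proof -
    have "W $ i $ j * complex_of_real (f (d j)) = complex_of_real (f (e i)) * W $ i $ j" for i j
    proof -
      have "(W ** real_diag d) $ i $ j = (real_diag e ** W) $ i $ j"
        using comm by simp
      then have "W $ i $ j = 0 \<or> d j = e i"
        by (auto simp: real_diag_mult_left real_diag_mult_right)
      then show ?thesis by auto
    qed
    then show ?thesis
      by (simp add: vec_eq_iff real_diag_mult_left real_diag_mult_right)
  qed
  then have "V ** (W ** real_diag (\<lambda>i. f (d i))) ** adjoint_mat U
           = V ** (real_diag (\<lambda>i. f (e i)) ** W) ** adjoint_mat U"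
    by simp
  then show ?thesis
    by (metis matrix_mul_assoc VW WU)
qed

lemma mat_fun_unitary_diag:
  assumes "unitary_mat U"
  shows "mat_fun f (U ** real_diag d ** adjoint_mat U)
       = U ** real_diag (\<lambda>i. f (d i)) ** adjoint_mat U"
  unfolding mat_fun_def
proof (rule the_equality)
  show "\<exists>V e. unitary_mat V \<and>
      U ** real_diag d ** adjoint_mat U = V ** real_diag e ** adjoint_mat V \<and>
      U ** real_diag (\<lambda>i. f (d i)) ** adjoint_mat U
        = V ** real_diag (\<lambda>i. f (e i)) ** adjoint_mat V"
    using assms by blast
next
  fix B
  assume "\<exists>V e. unitary_mat V \<and>
      U ** real_diag d ** adjoint_mat U = V ** real_diag e ** adjoint_mat V \<and>
      B = V ** real_diag (\<lambda>i. f (e i)) ** adjoint_mat V"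
  then show "B = U ** real_diag (\<lambda>i. f (d i)) ** adjoint_mat U"
    using mat_fun_unique[OF assms] by metis
qed

end

theory Submission
  imports Defs
begin

text \<open>
  Put \<open>r = 1/p\<close>, \<open>B\<^sub>i = A\<^sub>i\<^sup>p\<close>, \<open>X = \<Sum> Z\<^sub>i* B\<^sub>i Z\<^sub>i\<close> and \<open>S = \<Sum> Z\<^sub>i* B\<^sub>i\<^sup>r Z\<^sub>i\<close>, so that the claim
  compares \<open>X\<close> with \<open>S\<^sup>p\<close>.  The convex function \<open>t\<^sup>p\<close> is awkward for matrices, but its inverse
  \<open>t\<^sup>r\<close> is operator concave, and the work is done there: the eigenvalues of \<open>X\<^sup>r\<close> are weakly
  majorized by those of \<open>S\<close>.  Convexity is then needed for numbers only
  (\<open>weak_majorization_powr\<close>): it carries the majorization from \<open>x\<^sup>r\<close> and \<open>s\<close> to \<open>x\<close> and \<open>s\<^sup>p\<close>,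
  where \<open>x\<close> and \<open>s\<close> are the decreasingly ordered eigenvalues of \<open>X\<close> and \<open>S\<close>.

  For the majorization, work in an eigenbasis of \<open>X\<close> in which \<open>X = diag x\<close> with \<open>x\<close> decreasing.
  For decreasing weights \<open>w \<ge> 0\<close> one shows
  \<open>\<Sum> w\<^sub>j x\<^sub>j\<^sup>r \<le> \<Sum> w\<^sub>j S\<^sub>j\<^sub>j\<close>  (\<open>weighted_trace_powr_compression\<close>);
  the right-hand side is at most \<open>\<Sum> w\<^sub>j s\<^sub>j\<close> by Ky Fan's principle
  (\<open>doubly_stochastic_rearrangement\<close>).  Since \<open>t\<^sup>r\<close> is a positive mixture over \<open>\<sigma> > 0\<close> of the functions
  \<open>t/(t+\<sigma>)\<close>, and neither the eigenbases nor the weights depend on \<open>\<sigma>\<close>, it suffices to treat these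
  functions (\<open>resolvent_compression\<close>).  That case is a minimization: \<open>C* (B+\<sigma>)\<^sup>-\<^sup>1 C\<close> dominates
  \<open>C* K + K* C - K* (B+\<sigma>) K\<close> for every \<open>K\<close>, and a suitable \<open>K\<close>, built from the polar decomposition of
  \<open>C = B\<^sup>1\<^sup>/\<^sup>2 Z\<close> and the resolvent of \<open>diag x\<close>, makes the lower bound comparable with
  \<open>diag x\<close>.  Here expansiveness enters in the form \<open>C C* \<ge> B\<close>.  The factors that do not commute are
  reordered under the weighted trace by \<open>weighted_trace_rearrangement\<close>, which rests on the
  common ordering of \<open>w\<close> and \<open>x\<close>.

  Finally, weak majorization of nonnegative diagonals implies the inequality for every symmetric
  norm (\<open>symmetric_norm_weak_majorization\<close>), by separating \<open>diag x\<close> from a convex hull on which the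
  norm is bounded.

  The spectral theorem with ordered eigenvalues and the polar decomposition are both obtained by
  maximizing a linear or quadratic functional over the compact group of unitary matrices.
\<close>

section \<open>Adjoints, unitary and positive semidefinite matrices\<close>

definition cinner_prod :: "complex ^ 'n \<Rightarrow> complex ^ 'n \<Rightarrow> complex" where
  "cinner_prod x y = (\<Sum>i\<in>UNIV. cnj (x $ i) * y $ i)"

lemma adjoint_nth [simp]: "adjoint_mat A $ i $ j = cnj (A $ j $ i)"
  by (simp add: adjoint_mat_def transpose_def)

lemma adjoint_adjoint [simp]: "adjoint_mat (adjoint_mat A) = A"
  by (simp add: vec_eq_iff)

lemma adjoint_mult: "adjoint_mat (A ** B) = adjoint_mat B ** adjoint_mat A"
  by (simp add: vec_eq_iff matrix_matrix_mult_def mult.commute)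

lemma adjoint_add: "adjoint_mat (A + B) = adjoint_mat A + adjoint_mat B"
  by (simp add: vec_eq_iff)

lemma adjoint_diff: "adjoint_mat (A - B) = adjoint_mat A - adjoint_mat B"
  by (simp add: vec_eq_iff)

lemma adjoint_mat_1 [simp]: "adjoint_mat (mat 1) = mat 1"
  by (simp add: vec_eq_iff mat_def)

lemma adjoint_real_diag [simp]: "adjoint_mat (real_diag d) = real_diag d"
  by (simp add: vec_eq_iff real_diag_def)

lemma matrix_diff_ldistrib: "A ** (B - C) = A ** B - A ** (C :: 'a :: ring_1 ^ _ ^ _)"
  by (simp add: vec_eq_iff matrix_matrix_mult_def sum_subtractf right_diff_distrib)

lemma matrix_diff_rdistrib: "(B - C) ** A = B ** A - (C :: 'a :: ring_1 ^ _ ^ _) ** A"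
  by (simp add: vec_eq_iff matrix_matrix_mult_def sum_subtractf left_diff_distrib)

lemma matrix_add_rdistrib: "(B + C) ** A = B ** A + (C :: 'a :: ring_1 ^ _ ^ _) ** A"
  by (simp add: vec_eq_iff matrix_matrix_mult_def sum.distrib distrib_right)

lemma matrix_sum_rdistrib: "(\<Sum>i\<in>I. B i) ** A = (\<Sum>i\<in>I. B i ** (A :: complex ^ _ ^ _))"
  by (induction I rule: infinite_finite_induct) (simp_all add: matrix_add_rdistrib)

lemma matrix_sum_ldistrib: "A ** (\<Sum>i\<in>I. B i) = (\<Sum>i\<in>I. (A :: complex ^ _ ^ _) ** B i)"
  by (induction I rule: infinite_finite_induct) (simp_all add: matrix_add_ldistrib)

lemmas matrix_distribs =
  matrix_diff_ldistrib matrix_diff_rdistrib matrix_add_ldistrib matrix_add_rdistrib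

lemma real_diag_mult_diag: "real_diag d ** real_diag e = real_diag (\<lambda>i. d i * e i)"
  by (simp add: vec_eq_iff real_diag_mult_left) (simp add: real_diag_def)

lemma real_diag_1: "real_diag (\<lambda>i. 1) = mat 1"
  by (simp add: vec_eq_iff real_diag_def mat_def)

lemma unitaryD:
  assumes "unitary_mat U"
  shows "adjoint_mat U ** U = mat 1" "U ** adjoint_mat U = mat 1"
    "adjoint_mat U ** (U ** X) = X" "U ** (adjoint_mat U ** X) = X"
  using assms by (auto simp: unitary_mat_def matrix_mul_assoc)

lemma unitaryI:
  fixes U :: "complex ^ 'n ^ 'n"
  assumes "adjoint_mat U ** U = mat 1"
  shows "unitary_mat U"
  using assms matrix_left_right_inverse unfolding unitary_mat_def by blast

lemma unitary_iff_entries: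
  fixes U :: "complex ^ 'n ^ 'n"
  shows "unitary_mat U \<longleftrightarrow>
    (\<forall>a b. (\<Sum>c\<in>UNIV. cnj (U $ c $ a) * U $ c $ b) = (if a = b then 1 else 0))"
proof -
  have "unitary_mat U \<longleftrightarrow> adjoint_mat U ** U = mat 1"
    using unitaryI unitary_mat_def by blast
  then show ?thesis
    by (simp add: vec_eq_iff matrix_matrix_mult_def mat_def)
qed

lemma unitary_adjoint: "unitary_mat U \<Longrightarrow> unitary_mat (adjoint_mat U)"
  by (simp add: unitary_mat_def)

lemma unitary_mult:
  assumes "unitary_mat U" "unitary_mat V"
  shows "unitary_mat (U ** V)"
  by (rule unitaryI)
     (simp add: adjoint_mult matrix_mul_assoc[symmetric] unitaryD[OF assms(1)] unitaryD[OF assms(2)])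

lemma unitary_1 [simp]: "unitary_mat (mat 1)"
  by (simp add: unitary_mat_def)

lemma unitary_real_diag_sign:
  assumes "\<And>i. \<epsilon> i = 1 \<or> \<epsilon> i = (-1::real)"
  shows "unitary_mat (real_diag \<epsilon>)"
proof -
  have "\<epsilon> i * \<epsilon> i = 1" for i
    using assms[of i] by auto
  then show ?thesis
    by (simp add: unitary_mat_def real_diag_mult_diag real_diag_1)
qed

lemma sum_row_unitary:
  assumes "unitary_mat U"
  shows "(\<Sum>k\<in>UNIV. (cmod (U $ j $ k))\<^sup>2) = 1"
proof -
  have "(U ** adjoint_mat U) $ j $ j = 1"
    using assms by (simp add: unitary_mat_def mat_def)
  then have "complex_of_real (\<Sum>k\<in>UNIV. (cmod (U $ j $ k))\<^sup>2) = 1"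
    by (simp add: matrix_matrix_mult_def complex_norm_square[symmetric])
  then show ?thesis
    using of_real_eq_1_iff by blast
qed

lemma sum_column_unitary:
  assumes "unitary_mat U"
  shows "(\<Sum>j\<in>UNIV. (cmod (U $ j $ k))\<^sup>2) = 1"
  using sum_row_unitary[OF unitary_adjoint[OF assms], of k] by simp

text \<open>
  Compactness provides the maximizers from which the polar and the spectral decompositions are read off.
\<close>

lemma compact_unitary: "compact {U :: complex ^ 'n ^ 'n. unitary_mat U}"
  unfolding compact_eq_bounded_closed
proof
  have "norm U \<le> (\<Sum>j\<in>(UNIV::'n set). \<Sum>k\<in>(UNIV::'n set). 1)"
    if "unitary_mat U" for U :: "complex ^ 'n ^ 'n"
  proof -
    have "cmod (U $ j $ k) \<le> 1" for j k
    proof -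
      have "(cmod (U $ j $ k))\<^sup>2 \<le> (\<Sum>k\<in>UNIV. (cmod (U $ j $ k))\<^sup>2)"
        by (rule member_le_sum) auto
      then show ?thesis
        using sum_row_unitary[OF that, of j] by (simp add: abs_square_le_1)
    qed
    moreover have "norm U \<le> (\<Sum>j\<in>UNIV. norm (U $ j))"
      by (simp add: norm_vec_def L2_set_le_sum)
    moreover have "norm (U $ j) \<le> (\<Sum>k\<in>UNIV. cmod (U $ j $ k))" for j
      by (simp add: norm_vec_def[of "U $ j"] L2_set_le_sum)
    ultimately show ?thesis
      by (meson order.trans sum_mono)
  qed
  then show "bounded {U :: complex ^ 'n ^ 'n. unitary_mat U}"
    unfolding bounded_iff by blast
  show "closed {U :: complex ^ 'n ^ 'n. unitary_mat U}"
    unfolding unitary_iff_entries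
    by (intro closed_Collect_all closed_Collect_eq continuous_intros)
qed

lemma cinner_add_left: "cinner_prod (x + y) z = cinner_prod x z + cinner_prod y z"
  by (simp add: cinner_prod_def distrib_right sum.distrib)

lemma cinner_axis_left: "cinner_prod (axis a z) y = cnj z * y $ a"
proof -
  have "cinner_prod (axis a z) y = (\<Sum>i\<in>UNIV. if i = a then cnj z * y $ a else 0)"
    unfolding cinner_prod_def by (rule sum.cong) (auto simp: axis_def)
  then show ?thesis by simp
qed

lemma mult_axis_nth: "(A *v axis b z) $ a = (A $ a $ b :: complex) * z"
proof -
  have "(A *v axis b z) $ a = (\<Sum>i\<in>UNIV. if i = b then A $ a $ b * z else 0)"
    unfolding matrix_vector_mult_def vec_lambda_beta by (rule sum.cong) (auto simp: axis_def)
  then show ?thesis by simp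
qed

lemma psd_iff: "psd A \<longleftrightarrow> adjoint_mat A = A \<and> (\<forall>x. 0 \<le> Re (cinner_prod x (A *v x)))"
  by (simp add: psd_def cinner_prod_def)

lemma cinner_adjoint: "cinner_prod x (adjoint_mat K *v y) = cinner_prod (K *v x) y"
  unfolding cinner_prod_def matrix_vector_mult_def
  by (simp add: sum_distrib_left sum_distrib_right mult_ac) (rule sum.swap)

lemma psd_conj: "psd A \<Longrightarrow> psd (adjoint_mat K ** A ** K)"
  by (simp add: psd_iff adjoint_mult matrix_mul_assoc
      matrix_vector_mul_assoc[symmetric] cinner_adjoint)

lemma psd_add: "psd A \<Longrightarrow> psd B \<Longrightarrow> psd (A + B)"
  unfolding psd_iff
  by (auto simp: adjoint_add matrix_vector_mult_add_rdistrib cinner_prod_def distrib_left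
      sum.distrib)

lemma psd_0: "psd 0"
  by (simp add: psd_iff cinner_prod_def) (simp add: vec_eq_iff)

lemma psd_sum: "(\<And>i. i \<in> I \<Longrightarrow> psd (A i)) \<Longrightarrow> psd (\<Sum>i\<in>I. A i)"
  by (induction I rule: infinite_finite_induct) (auto intro: psd_add psd_0)

lemma psd_diag_nonneg: "psd A \<Longrightarrow> 0 \<le> Re (A $ j $ j)"
  unfolding psd_iff by (metis cinner_axis_left mult_axis_nth complex_cnj_one mult_1 mult.right_neutral)

lemma psd_real_diag: "(\<And>i. 0 \<le> d i) \<Longrightarrow> psd (real_diag d)"
  unfolding psd_iff cinner_prod_def
proof (intro conjI allI)
  fix x :: "complex ^ 'a"
  assume d: "\<And>i. 0 \<le> d i"
  have v: "(real_diag d *v x) $ i = complex_of_real (d i) * x $ i" for i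
  proof -
    have "(real_diag d *v x) $ i = (\<Sum>j\<in>UNIV. if j = i then complex_of_real (d i) * x $ i else 0)"
      unfolding matrix_vector_mult_def vec_lambda_beta real_diag_def by (rule sum.cong) auto
    then show ?thesis by simp
  qed
  have "Re (cnj (x $ i) * (real_diag d *v x) $ i) = d i * (cmod (x $ i))\<^sup>2" for i
    unfolding v cmod_power2 by (simp add: algebra_simps power2_eq_square)
  then show "0 \<le> Re (\<Sum>i\<in>UNIV. cnj (x $ i) * (real_diag d *v x) $ i)"
    by (simp add: sum_nonneg d)
qed simp

text \<open>
  Over the complex numbers a real quadratic form forces the matrix to be Hermitian: the vectors
  \<open>e\<^sub>a + z e\<^sub>b\<close> with \<open>z = 1\<close> and \<open>z = \<i>\<close> recover the relation between the entries
  \<open>(a,b)\<close> and \<open>(b,a)\<close>.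
\<close>

lemma psd_quadratic_form:
  assumes "\<And>v. Im (cinner_prod v (M *v v)) = 0 \<and> 0 \<le> Re (cinner_prod v (M *v v))"
  shows "psd M"
  unfolding psd_iff
proof (intro conjI allI)
  have "Im (z * M $ a $ b + cnj z * M $ b $ a) = 0" for a b z
  proof -
    have *: "Im (M $ a $ a) = 0" for a
      using assms[of "axis a 1"] by (simp add: cinner_axis_left mult_axis_nth)
    have "cnj z * (M $ b $ b * z) = M $ b $ b * complex_of_real ((cmod z)\<^sup>2)"
      by (simp add: complex_norm_square[symmetric] mult_ac)
    then have "Im (cnj z * (M $ b $ b * z)) = 0"
      using *[of b] by simp
    then show ?thesis
      using assms[of "axis a 1 + axis b z"] *
      by (simp add: cinner_axis_left mult_axis_nth cinner_add_left matrix_vector_right_distrib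
          distrib_left del: times_complex.sel)
         (simp add: algebra_simps)
  qed
  from this[of 1] this[of \<i>]
  show "adjoint_mat M = M"
    by (simp add: vec_eq_iff complex_eq_iff) (metis add_eq_0_iff)
qed (use assms in auto)

section \<open>The polar decomposition\<close>

text \<open>
  The matrix is \<open>1 + (z - 1) P\<close> with \<open>P\<close> the orthogonal projection onto the line of \<open>v\<close>: it
  multiplies \<open>v\<close> by the phase \<open>z\<close> and fixes the orthogonal complement.
\<close>

lemma phase_rotation_unitary:
  fixes v :: "complex ^ 'n"
  assumes z: "cmod z = 1" and n: "(\<Sum>i\<in>UNIV. (cmod (v $ i))\<^sup>2) = n" "n \<noteq> 0"
  shows "unitary_mat (\<chi> a b. (if a = b then 1 else 0)
           + (z - 1) * (v $ a * cnj (v $ b) / complex_of_real n))"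
    (is "unitary_mat ?R")
  unfolding unitary_iff_entries
proof (intro allI)
  fix a b :: 'n
  define P where "P a b = v $ a * cnj (v $ b) / complex_of_real n" for a b
  have PP: "(\<Sum>c\<in>UNIV. cnj (P c a) * P c b) = P a b"
  proof -
    have "(\<Sum>c\<in>UNIV. cnj (P c a) * P c b)
        = (\<Sum>c\<in>UNIV. (v $ c * cnj (v $ c)) * (v $ a * cnj (v $ b) / (complex_of_real n)\<^sup>2))"
      by (simp add: P_def power2_eq_square mult_ac)
    also have "\<dots> = (\<Sum>c\<in>UNIV. v $ c * cnj (v $ c)) * (v $ a * cnj (v $ b) / (complex_of_real n)\<^sup>2)"
      by (rule sum_distrib_right[symmetric])
    also have "(\<Sum>c\<in>UNIV. v $ c * cnj (v $ c)) = complex_of_real n"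
      by (simp only: n(1)[symmetric] of_real_sum complex_norm_square)
    finally show ?thesis
      using n(2) by (simp add: P_def power2_eq_square)
  qed
  have "(\<Sum>c\<in>UNIV. cnj (?R $ c $ a) * ?R $ c $ b)
      = (\<Sum>c\<in>UNIV. (if c = a then (if a = b then 1 else 0) + (z - 1) * P a b else 0)
           + (if c = b then cnj (z - 1) * cnj (P b a) else 0)
           + (z - 1) * cnj (z - 1) * (cnj (P c a) * P c b))"
    by (rule sum.cong) (auto simp: P_def algebra_simps)
  also have "\<dots> = (if a = b then 1 else 0) + (z - 1) * P a b + cnj (z - 1) * cnj (P b a)
                 + (z - 1) * cnj (z - 1) * P a b"
    by (simp add: sum.distrib sum_distrib_left[symmetric] PP)
  also have "cnj (P b a) = P a b"
    by (simp add: P_def mult.commute)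
  also have "(z - 1) * cnj (z - 1) = - (z - 1) - cnj (z - 1)"
    using z by (simp add: algebra_simps complex_norm_square[symmetric])
  finally show "(\<Sum>c\<in>UNIV. cnj (?R $ c $ a) * ?R $ c $ b) = (if a = b then 1 else 0)"
    by (simp add: algebra_simps)
qed

text \<open>
  Let \<open>U\<close> maximize \<open>Re tr (U* C)\<close> and put \<open>M = U* C\<close>.  Changing \<open>U\<close> by the phase rotation
  along \<open>v\<close> that turns \<open>q = v* M v\<close> into its modulus cannot increase the trace, so
  \<open>\<bar>q\<bar> \<le> Re q\<close>; hence every \<open>v* M v\<close> is real and nonnegative.
\<close>

lemma polar_decomposition:
  fixes C :: "complex ^ 'n ^ 'n"
  obtains U Q where "unitary_mat U" "psd Q" "C = U ** Q"
proof -
  let ?f = "\<lambda>U. Re (trace (adjoint_mat U ** C))"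
  have "continuous_on {U. unitary_mat U} ?f"
    unfolding trace_def matrix_matrix_mult_def adjoint_nth vec_lambda_beta
    by (intro continuous_intros)
  then obtain U where U: "unitary_mat U" and max: "\<And>V. unitary_mat V \<Longrightarrow> ?f V \<le> ?f U"
    using continuous_attains_sup[OF compact_unitary, of ?f] unitary_1 by blast
  define M where "M = adjoint_mat U ** C"
  have le: "Re (trace (R ** M)) \<le> Re (trace M)" if "unitary_mat R" for R
    using max[of "U ** adjoint_mat R"] that U
    by (simp add: unitary_mult unitary_adjoint adjoint_mult M_def matrix_mul_assoc)
  have "psd M"
  proof (rule psd_quadratic_form)
    fix v :: "complex ^ 'n"
    define q where "q = cinner_prod v (M *v v)"
    define n where "n = (\<Sum>i\<in>UNIV. (cmod (v $ i))\<^sup>2)"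
    show "Im q = 0 \<and> 0 \<le> Re q"
    proof (cases "n = 0 \<or> q = 0")
      case True
      moreover have "q = 0" if "n = 0"
        using that by (simp add: n_def q_def cinner_prod_def sum_nonneg_eq_0_iff)
      ultimately show ?thesis by auto
    next
      case False
      then have n: "n > 0"
        by (metis n_def sum_nonneg zero_le_power2 order_less_le)
      \<comment> \<open>the phase that rotates \<open>q\<close> onto the positive real axis\<close>
      define z where "z = cnj q / cmod q"
      have z: "cmod z = 1" "z * q = cmod q"
        using False by (simp_all add: z_def norm_divide mult.commute[of "cnj q"]
            complex_norm_square[symmetric] power2_eq_square)
      define R :: "complex ^ 'n ^ 'n" where "R = (\<chi> a b. (if a = b then 1 else 0)
           + (z - 1) * (v $ a * cnj (v $ b) / complex_of_real n))"
      have R: "unitary_mat R"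
        unfolding R_def using phase_rotation_unitary[OF z(1) n_def[symmetric]] n by simp
      have "trace (R ** M) = (\<Sum>a\<in>UNIV. \<Sum>b\<in>UNIV. (if b = a then M $ a $ a else 0)
              + (z - 1) / n * (cnj (v $ b) * (M $ b $ a * v $ a)))"
        unfolding trace_def matrix_matrix_mult_def vec_lambda_beta
      proof (intro sum.cong refl)
        fix a b
        define \<kappa> where "\<kappa> = z - 1"
        show "R $ a $ b * M $ b $ a = (if b = a then M $ a $ a else 0)
              + (z - 1) / n * (cnj (v $ b) * (M $ b $ a * v $ a))"
          unfolding R_def \<kappa>_def[symmetric]
          by (cases "a = b") (simp_all add: distrib_right distrib_left mult_ac)
      qed
      also have "\<dots> = trace M + (z - 1) / n * (\<Sum>a\<in>UNIV. \<Sum>b\<in>UNIV. cnj (v $ b) * (M $ b $ a * v $ a))"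
        by (simp add: sum.distrib trace_def sum_distrib_left)
      also have "(\<Sum>a\<in>UNIV. \<Sum>b\<in>UNIV. cnj (v $ b) * (M $ b $ a * v $ a)) = q"
        unfolding q_def cinner_prod_def matrix_vector_mult_def vec_lambda_beta sum_distrib_left
        by (rule sum.swap)
      finally have "Re ((z - 1) / n * q) \<le> 0"
        using le[OF R] by simp
      also have "(z - 1) / n * q = (cmod q - q) / n"
        by (simp add: z(2) left_diff_distrib)
      finally have "cmod q \<le> Re q"
        using n by (simp add: divide_le_0_iff)
      then show ?thesis
        using complex_Re_le_cmod[of q] norm_ge_zero[of q] cmod_power2[of q] by simp
    qed
  qed
  moreover have "C = U ** M"
    using U by (simp add: M_def unitaryD)
  ultimately show ?thesis
    using that U by blast
qed

section \<open>The spectral theorem with ordered eigenvalues\<close>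

text \<open>
  The index type carries no order.  An enumeration \<open>e\<close> of the indices is fixed instead, and all
  eigenvalue families are arranged along it.
\<close>

definition decreasing_along :: "('n \<Rightarrow> nat) \<Rightarrow> ('n \<Rightarrow> real) \<Rightarrow> bool" where
  "decreasing_along e f \<longleftrightarrow> (\<forall>i j. e i \<le> e j \<longrightarrow> f j \<le> f i)"

lemma axis_nth_if: "axis i z $ j = (if j = i then z else 0)"
  by (simp add: axis_def)

text \<open>
  The columns \<open>r i\<close> and \<open>r j\<close> are a unitary rotation of the coordinate plane of \<open>i\<close> and \<open>j\<close>; the
  other columns are coordinate vectors.
\<close>

lemma plane_rotation_unitary:
  fixes i j :: "'n :: finite" and c :: real and s :: complex
  assumes "i \<noteq> j" and "c\<^sup>2 + (cmod s)\<^sup>2 = 1"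
  defines "r \<equiv> \<lambda>b. if b = i then axis i (complex_of_real c) + axis j s
                    else if b = j then axis i (- cnj s) + axis j (complex_of_real c)
                    else axis b 1"
  shows "unitary_mat (\<chi> a b. r b $ a)"
proof -
  have 1: "complex_of_real c * complex_of_real c + s * cnj s = 1"
  proof -
    have "complex_of_real (c\<^sup>2) + complex_of_real ((cmod s)\<^sup>2) = 1"
      using assms(2) by (metis of_real_add of_real_1)
    then show ?thesis
      unfolding complex_norm_square by (simp add: power2_eq_square)
  qed
  have "cinner_prod (r a) (r b) = (if a = b then 1 else 0)" for a b
    using assms(1) 1 unfolding r_def
    by (auto simp: cinner_add_left cinner_axis_left axis_nth_if mult_ac add_ac)
  then show ?thesis
    by (simp add: unitary_iff_entries cinner_prod_def)
qed

text \<open>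
  Let \<open>U\<close> maximize \<open>\<Sum> - e k Re (U* A U)\<^sub>k\<^sub>k\<close>.  The weights are strictly decreasing along \<open>e\<close>, so a
  rotation in the plane of two indices would increase the value both if the corresponding
  off-diagonal entry of \<open>U* A U\<close> were nonzero (small angle) and if the two diagonal entries were
  in the wrong order (right angle).  Diagonalization and ordering come from the same maximizer.
\<close>

lemma spectral_theorem_sorted:
  fixes A :: "complex ^ 'n ^ 'n" and e :: "'n \<Rightarrow> nat"
  assumes "inj e" and herm: "adjoint_mat A = A"
  obtains U d where "unitary_mat U" "decreasing_along e d"
    "A = U ** real_diag d ** adjoint_mat U"
proof -
  let ?f = "\<lambda>U. \<Sum>k\<in>UNIV. - real (e k) * Re ((adjoint_mat U ** A ** U) $ k $ k)"
  have "continuous_on {U. unitary_mat U} ?f"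
    unfolding matrix_matrix_mult_def adjoint_nth vec_lambda_beta
    by (intro continuous_intros)
  then obtain U where U: "unitary_mat U" and max: "\<And>V. unitary_mat V \<Longrightarrow> ?f V \<le> ?f U"
    using continuous_attains_sup[OF compact_unitary, of ?f] unitary_1 by blast
  define M where "M = adjoint_mat U ** A ** U"
  define m where "m = (\<lambda>k. Re (M $ k $ k))"
  have "adjoint_mat M = M"
    by (simp add: M_def adjoint_mult matrix_mul_assoc herm)
  then have M_sym: "M $ b $ a = cnj (M $ a $ b)" for a b
    by (metis adjoint_nth)
  \<comment> \<open>rotating the columns \<open>i\<close> and \<open>j\<close> moves the amount on the
      left from the diagonal entry \<open>j\<close> to the entry \<open>i\<close>, which has the larger
      weight\<close>
  have rot: "(cmod s)\<^sup>2 * (m j - m i) + 2 * c * Re (s * M $ i $ j) \<le> 0"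
    if ij: "e i < e j" and cs: "c\<^sup>2 + (cmod s)\<^sup>2 = 1" for i j c s
  proof -
    define r where "r = (\<lambda>b. if b = i then axis i (complex_of_real c) + axis j s
                    else if b = j then axis i (- cnj s) + axis j (complex_of_real c)
                    else axis b 1)"
    define R where "R = (\<chi> a b. r b $ a)"
    have neq: "i \<noteq> j" using ij by auto
    have "unitary_mat R"
      unfolding R_def r_def using plane_rotation_unitary[OF neq cs] .
    then have le: "?f (U ** R) \<le> ?f U"
      using max U unitary_mult by blast
    define q where "q = (\<lambda>k. Re ((adjoint_mat (U ** R) ** A ** (U ** R)) $ k $ k))"
    have q: "q b = Re (cinner_prod (r b) (M *v r b))" for b
    proof -
      have "adjoint_mat (U ** R) ** A ** (U ** R) = adjoint_mat R ** (M ** R)"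
        by (simp add: M_def adjoint_mult matrix_mul_assoc)
      moreover have "(adjoint_mat R ** (M ** R)) $ b $ b = cinner_prod (r b) (M *v r b)"
        by (simp add: matrix_matrix_mult_def cinner_prod_def matrix_vector_mult_def R_def)
      ultimately show ?thesis by (simp add: q_def)
    qed
    have c2: "c\<^sup>2 = 1 - (cmod s)\<^sup>2" using cs by simp
    have qi: "q i - m i = (cmod s)\<^sup>2 * (m j - m i) + 2 * c * Re (s * M $ i $ j)"
    proof -
      have "q i = c\<^sup>2 * m i + (cmod s)\<^sup>2 * m j + 2 * c * Re (s * M $ i $ j)"
        unfolding q r_def m_def cmod_power2 using M_sym[of j i]
        by (simp add: cinner_add_left cinner_axis_left matrix_vector_right_distrib mult_axis_nth
            algebra_simps power2_eq_square)
      then show ?thesis unfolding c2 by (simp add: algebra_simps)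
    qed
    have qj: "q j - m j = - (q i - m i)"
    proof -
      have "q j = (cmod s)\<^sup>2 * m i + c\<^sup>2 * m j - 2 * c * Re (s * M $ i $ j)"
        unfolding q r_def m_def cmod_power2 using M_sym[of j i] neq
        by (simp add: cinner_add_left cinner_axis_left matrix_vector_right_distrib mult_axis_nth
            algebra_simps power2_eq_square)
      then show ?thesis unfolding qi c2 by (simp add: algebra_simps)
    qed
    have qk: "q k = m k" if "k \<notin> {i, j}" for k
      using that unfolding q r_def m_def by (simp add: cinner_axis_left mult_axis_nth)
    have "(\<Sum>k\<in>UNIV. - real (e k) * (q k - m k)) \<le> 0"
      using le by (simp add: q_def m_def M_def right_diff_distrib sum_subtractf sum_negf)
    also have "(\<Sum>k\<in>UNIV. - real (e k) * (q k - m k)) = (\<Sum>k\<in>{i, j}. - real (e k) * (q k - m k))"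
      by (rule sum.mono_neutral_right) (auto simp: qk)
    also have "\<dots> = - real (e i) * (q i - m i) + - real (e j) * (q j - m j)"
      using neq by simp
    also have "\<dots> = (real (e j) - real (e i)) * (q i - m i)"
      unfolding qj by (simp add: algebra_simps)
    finally show ?thesis
      using ij unfolding qi[symmetric] by (simp add: mult_le_0_iff)
  qed
  \<comment> \<open>the right angle \<open>c = 0\<close>, \<open>s = 1\<close> exchanges the two diagonal
      entries\<close>
  have sorted: "m j \<le> m i" if "e i \<le> e j" for i j
  proof (cases "e i = e j")
    case True
    then show ?thesis using \<open>inj e\<close> by (simp add: inj_eq)
  next
    case False
    then show ?thesis using rot[of i j 0 1] that by simp
  qed
  have offdiag: "M $ i $ j = 0" if ij: "e i < e j" for i j
  proof (rule ccontr)
    assume nz: "M $ i $ j \<noteq> 0"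
    define a where "a = cmod (M $ i $ j)"
    define K where "K = m j - m i"
    \<comment> \<open>the tangent of the angle, so small that the linear term \<open>2 a t\<close>
        outweighs the quadratic term \<open>K t\<^sup>2\<close>\<close>
    define t where "t = a / (\<bar>K\<bar> + 1)"
    define h where "h = sqrt (1 + t\<^sup>2)"
    have a: "a > 0" using nz by (simp add: a_def)
    have t: "t > 0" using a by (simp add: t_def)
    have h: "h > 0" "h\<^sup>2 = 1 + t\<^sup>2"
      by (simp_all add: h_def add_pos_nonneg)
    \<comment> \<open>the phase of \<open>s\<close> makes \<open>s * M $ i $ j\<close> positive\<close>
    define s where "s = complex_of_real (t / h / a) * cnj (M $ i $ j)"
    have cs: "cmod s = t / h"
      unfolding s_def norm_mult norm_of_real complex_mod_cnj a_def[symmetric]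
      using a t h by simp
    have sM: "s * M $ i $ j = complex_of_real (t / h * a)"
    proof -
      have "s * M $ i $ j = complex_of_real (t / h / a) * complex_of_real (a\<^sup>2)"
        unfolding s_def a_def complex_norm_square by (simp add: mult_ac)
      also have "\<dots> = complex_of_real (t / h * a)"
        using a by (simp add: power2_eq_square)
      finally show ?thesis .
    qed
    have "(1 / h)\<^sup>2 + (cmod s)\<^sup>2 = 1"
      unfolding cs power_divide h(2) using h(1)
      by (simp add: add_divide_distrib[symmetric]) (smt (verit) zero_le_power2)
    from rot[OF ij this] have "(t / h)\<^sup>2 * K + 2 * (1 / h) * (t / h * a) \<le> 0"
      unfolding cs sM K_def by simp
    then have "h\<^sup>2 * ((t / h)\<^sup>2 * K + 2 * (1 / h) * (t / h * a)) \<le> 0"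
      by (simp add: mult_le_0_iff)
    also have "h\<^sup>2 * ((t / h)\<^sup>2 * K + 2 * (1 / h) * (t / h * a)) = t * (t * K + 2 * a)"
      using h(1) by (simp add: field_simps power2_eq_square)
    finally have "t * K + 2 * a \<le> 0"
      using t by (simp add: mult_le_0_iff)
    moreover have "t * \<bar>K\<bar> \<le> a"
      using a by (simp add: t_def field_simps)
    moreover have "t * - \<bar>K\<bar> \<le> t * K"
      using t by (intro mult_left_mono) auto
    ultimately show False using a by simp
  qed
  have "M $ i $ j = real_diag m $ i $ j" for i j
  proof (cases "i = j")
    case True
    then show ?thesis
      using M_sym[of i i] by (simp add: real_diag_def m_def complex_eq_iff)
  next
    case False
    then have "e i < e j \<or> e j < e i"
      using \<open>inj e\<close> by (metis inj_eq nat_neq_iff)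
    then have "M $ i $ j = 0"
      using offdiag[of i j] offdiag[of j i] M_sym[of i j] by auto
    then show ?thesis using False by (simp add: real_diag_def)
  qed
  then have M: "M = real_diag m"
    by (simp add: vec_eq_iff)
  have "A = U ** real_diag m ** adjoint_mat U"
    unfolding M[symmetric] M_def
    using U by (simp add: matrix_mul_assoc[symmetric] unitaryD)
  moreover have "decreasing_along e m"
    using sorted by (simp add: decreasing_along_def)
  ultimately show ?thesis
    using that U by blast
qed

lemma psd_spectral_sorted:
  fixes A :: "complex ^ 'n ^ 'n" and e :: "'n \<Rightarrow> nat"
  assumes "inj e" and "psd A"
  obtains U d where "unitary_mat U" "decreasing_along e d" "\<And>i. 0 \<le> d i"
    "A = U ** real_diag d ** adjoint_mat U"
proof -
  obtain U d where U: "unitary_mat U" "decreasing_along e d" "A = U ** real_diag d ** adjoint_mat U"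
    using spectral_theorem_sorted[OF assms(1)] assms(2) unfolding psd_iff by metis
  have "real_diag d = adjoint_mat U ** A ** U"
    unfolding U(3) using U(1) by (simp add: matrix_mul_assoc[symmetric] unitaryD)
  then have "psd (real_diag d)"
    using psd_conj assms(2) by metis
  then have "0 \<le> d i" for i
    using psd_diag_nonneg[of "real_diag d" i] by (simp add: real_diag_def)
  then show ?thesis using that U by blast
qed

section \<open>The rearrangement inequality for doubly stochastic matrices\<close>

text \<open>
  Summation by parts.  Since the total of the \<open>v i\<close> vanishes, the weights may have any sign.
\<close>

lemma sum_weighted_nonneg:
  fixes v w :: "nat \<Rightarrow> real"
  assumes part: "\<And>k. k \<le> n \<Longrightarrow> 0 \<le> (\<Sum>i<k. v i)" and tot: "(\<Sum>i<n. v i) = 0"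
    and dec: "\<And>i j. i \<le> j \<Longrightarrow> j < n \<Longrightarrow> w j \<le> w i"
  shows "0 \<le> (\<Sum>i<n. w i * v i)"
proof (cases n)
  case (Suc m)
  have "w k * (\<Sum>i<Suc k. v i) \<le> (\<Sum>i<Suc k. w i * v i)" if "k < n" for k
    using that
  proof (induction k)
    case (Suc k)
    have "w (Suc k) * (\<Sum>i<Suc k. v i) \<le> w k * (\<Sum>i<Suc k. v i)"
      using Suc.prems by (intro mult_right_mono dec part) auto
    also have "\<dots> \<le> (\<Sum>i<Suc k. w i * v i)"
      using Suc by simp
    finally show ?case
      by (simp add: distrib_left)
  qed simp
  from this[of m] show ?thesis
    using tot Suc by simp
qed simp

text \<open>
  By summation by parts in \<open>j\<close> it is enough to compare the partial sums of \<open>c\<close> with those of its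
  average under \<open>M\<close>: the latter are combinations of the values of \<open>c\<close> with coefficients in
  \<open>[0,1]\<close> of total \<open>k\<close>, so they cannot exceed the sum of the \<open>k\<close> largest values.  With \<open>M\<close> the squared
  moduli of the entries of a unitary matrix, this is Ky Fan's maximum principle.
\<close>

lemma doubly_stochastic_rearrangement:
  fixes M :: "'n::finite \<Rightarrow> 'n \<Rightarrow> real" and e :: "'n \<Rightarrow> nat"
  assumes e: "bij_betw e UNIV {..<CARD('n)}"
    and M: "\<And>j k. 0 \<le> M j k" "\<And>j. (\<Sum>k\<in>UNIV. M j k) = 1" "\<And>k. (\<Sum>j\<in>UNIV. M j k) = 1"
    and x: "decreasing_along e x" and c: "decreasing_along e c"
  shows "(\<Sum>j\<in>UNIV. x j * (\<Sum>k\<in>UNIV. M j k * c k)) \<le> (\<Sum>j\<in>UNIV. x j * c j)"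
proof -
  let ?n = "CARD('n)"
  define g where "g = inv_into UNIV e"
  have g: "bij_betw g {..<?n} UNIV"
    unfolding g_def using e by (rule bij_betw_inv_into)
  have eg: "e (g i) = i" if "i < ?n" for i
    unfolding g_def using bij_betw_inv_into_right[OF e] that by simp
  have ge: "g (e j) = j" for j
    unfolding g_def using bij_betw_inv_into_left[OF e] by simp
  have e_lt: "e j < ?n" for j
    using e by (auto simp: bij_betw_def)
  define v where "v = (\<lambda>j. c j - (\<Sum>k\<in>UNIV. M j k * c k))"
  have tot: "(\<Sum>j\<in>UNIV. v j) = 0"
  proof -
    have "(\<Sum>j\<in>UNIV. \<Sum>k\<in>UNIV. M j k * c k) = (\<Sum>k\<in>UNIV. \<Sum>j\<in>UNIV. M j k * c k)"
      by (rule sum.swap)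
    also have "\<dots> = (\<Sum>k\<in>UNIV. c k)"
      by (simp add: sum_distrib_right[symmetric] M)
    finally show ?thesis by (simp add: v_def sum_subtractf)
  qed
  have part: "0 \<le> (\<Sum>i<k. v (g i))" if "k \<le> ?n" for k
  proof (cases "k = 0")
    case False
    define K where "K = {j. e j < k}"
    have "bij_betw g {..<k} K"
      unfolding bij_betw_def K_def
    proof
      show "inj_on g {..<k}"
        using g that by (meson bij_betw_imp_inj_on inj_on_subset lessThan_subset_iff)
      show "g ` {..<k} = {j. e j < k}"
      proof
        show "g ` {..<k} \<subseteq> {j. e j < k}"
          using eg that by auto
        show "{j. e j < k} \<subseteq> g ` {..<k}"
          using ge by (metis (mono_tags, lifting) imageI lessThan_iff mem_Collect_eq subsetI)
      qed
    qed
    then have "(\<Sum>i<k. v (g i)) = (\<Sum>j\<in>K. v j)"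
      by (rule sum.reindex_bij_betw)
    also have "\<dots> = (\<Sum>k\<in>UNIV. ((if k \<in> K then 1 else 0) - (\<Sum>j\<in>K. M j k)) * c k)"
    proof -
      have "(\<Sum>j\<in>K. \<Sum>k\<in>UNIV. M j k * c k) = (\<Sum>k\<in>UNIV. (\<Sum>j\<in>K. M j k) * c k)"
        by (subst sum.swap) (simp add: sum_distrib_right)
      moreover have "(\<Sum>j\<in>K. c j) = (\<Sum>k\<in>UNIV. (if k \<in> K then 1 else 0) * c k)"
        by (simp add: if_distrib[of "\<lambda>z. z * _"] sum.If_cases cong: if_cong)
      ultimately show ?thesis
        by (simp add: v_def sum_subtractf left_diff_distrib)
    qed
    finally have eq: "(\<Sum>i<k. v (g i)) = (\<Sum>k\<in>UNIV. ((if k \<in> K then 1 else 0) - (\<Sum>j\<in>K. M j k)) * c k)" .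
    \<comment> \<open>\<open>\<tau>\<close> is the \<open>k\<close>-th largest value of \<open>c\<close>;
        subtracting it from \<open>c\<close> does not change the partial sum, and makes every term
        nonnegative\<close>
    define \<tau> where "\<tau> = c (g (k - 1))"
    have kk: "e (g (k - 1)) = k - 1"
      using False that by (intro eg) simp
    have "(\<Sum>k\<in>UNIV. (if k \<in> K then 1 else 0) - (\<Sum>j\<in>K. M j k)) = 0"
      by (simp add: sum_subtractf sum.If_cases) (subst sum.swap, simp add: M)
    then have "(\<Sum>k\<in>UNIV. ((if k \<in> K then 1 else 0) - (\<Sum>j\<in>K. M j k)) * \<tau>) = 0"
      by (simp add: sum_distrib_right[symmetric])
    then have "(\<Sum>i<k. v (g i))
        = (\<Sum>k\<in>UNIV. ((if k \<in> K then 1 else 0) - (\<Sum>j\<in>K. M j k)) * (c k - \<tau>))"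
      unfolding eq right_diff_distrib sum_subtractf by simp
    also have "0 \<le> \<dots>"
    proof (rule sum_nonneg)
      fix l
      have m: "0 \<le> (\<Sum>j\<in>K. M j l)" "(\<Sum>j\<in>K. M j l) \<le> 1"
        using sum_mono2[of UNIV K "\<lambda>j. M j l"] by (auto simp: M intro: sum_nonneg)
      show "0 \<le> ((if l \<in> K then 1 else 0) - (\<Sum>j\<in>K. M j l)) * (c l - \<tau>)"
      proof (cases "l \<in> K")
        case True
        then have "\<tau> \<le> c l"
          using c kk False unfolding decreasing_along_def \<tau>_def K_def by auto
        then show ?thesis using True m by simp
      next
        case notin: False
        then have "c l \<le> \<tau>"
          using c kk False unfolding decreasing_along_def \<tau>_def K_def by auto
        then show ?thesis using notin m by (simp add: mult_nonneg_nonpos)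
      qed
    qed
    finally show ?thesis .
  qed simp
  have "0 \<le> (\<Sum>i<?n. x (g i) * v (g i))"
  proof (rule sum_weighted_nonneg)
    show "(\<Sum>i<?n. v (g i)) = 0"
      using tot sum.reindex_bij_betw[OF g, of v] by simp
    show "x (g j) \<le> x (g i)" if "i \<le> j" "j < ?n" for i j
      using x that eg unfolding decreasing_along_def by simp
  qed (rule part)
  also have "\<dots> = (\<Sum>j\<in>UNIV. x j * v j)"
    by (rule sum.reindex_bij_betw[OF g])
  finally show ?thesis
    by (simp add: v_def right_diff_distrib sum_subtractf)
qed

section \<open>Fractional powers as mixtures of resolvents\<close>

text \<open>
  The substitution \<open>s = t u\<close> takes the factor \<open>t powr r\<close> out of the integral; the remaining integral
  \<open>c\<close> converges at \<open>0\<close> because \<open>r > 0\<close> and at infinity because \<open>r < 1\<close>.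
\<close>

lemma powr_resolvent_integral:
  fixes r :: real
  assumes r: "0 < r" "r < 1"
  obtains c where "c > 0"
    "\<And>t. 0 \<le> t \<Longrightarrow> has_bochner_integral lborel
        (\<lambda>s. indicator {0<..} s * (s powr (r - 1) * (t / (t + s)))) (c * t powr r)"
proof -
  define g :: "real \<Rightarrow> real" where "g = (\<lambda>u. indicator {0<..} u * (u powr (r - 1) * (1 / (1 + u))))"
  have g_meas [measurable]: "g \<in> borel_measurable borel"
    unfolding g_def by measurable
  have 1: "integrable lborel (\<lambda>u::real. indicator {0..1} u *\<^sub>R u powr (r - 1))"
  proof -
    have "(\<lambda>u::real. u powr (r - 1)) integrable_on {0..1}"
      using r by (intro integrable_on_powr_from_0) auto
    then have "(\<lambda>u::real. u powr (r - 1)) absolutely_integrable_on {0..1}"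
      by (subst absolutely_integrable_on_iff_nonneg) auto
    then show ?thesis
      unfolding set_integrable_def by (subst (asm) integrable_completion) auto
  qed
  have 2: "integrable lborel (\<lambda>u::real. indicator {1..} u *\<^sub>R u powr (r - 2))"
  proof -
    have "(\<lambda>u::real. u powr (r - 2)) integrable_on {1..}"
      using has_integral_powr_to_inf[of "r - 2" 1] r by (auto simp: integrable_on_def)
    then have "(\<lambda>u::real. u powr (r - 2)) absolutely_integrable_on {1..}"
      by (subst absolutely_integrable_on_iff_nonneg) auto
    then show ?thesis
      unfolding set_integrable_def by (subst (asm) integrable_completion) auto
  qed
  have g_int: "integrable lborel g"
  proof (rule Bochner_Integration.integrable_bound[OF Bochner_Integration.integrable_add[OF 1 2]])
    show "AE u in lborel. norm (g u)
        \<le> norm (indicator {0..1} u *\<^sub>R u powr (r - 1) + indicator {1..} u *\<^sub>R u powr (r - 2))"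
    proof (rule AE_I2)
      fix u :: real
      show "norm (g u)
        \<le> norm (indicator {0..1} u *\<^sub>R u powr (r - 1) + indicator {1..} u *\<^sub>R u powr (r - 2))"
      proof (cases "u \<le> 0")
        case True
        then show ?thesis by (simp add: g_def)
      next
        case u: False
        show ?thesis
        proof (cases "u \<le> 1")
          case True
          have "u powr (r - 1) * (1 / (1 + u)) \<le> u powr (r - 1) * 1"
            using u by (intro mult_left_mono) auto
          also have "\<dots> \<le> u powr (r - 1) + indicator {1..} u * u powr (r - 2)"
            by simp
          finally show ?thesis
            using u True by (simp add: g_def abs_of_nonneg)
        next
          case False
          have "u powr (r - 1) * (1 / (1 + u)) \<le> u powr (r - 1) * (1 / u)"
            using u by (intro mult_left_mono) (auto simp: field_simps)
          also have "\<dots> = u powr (r - 2)"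
            using u powr_diff[of u "r - 1" 1] by simp
          finally show ?thesis
            using u False by (simp add: g_def abs_of_nonneg)
        qed
      qed
    qed
  qed simp
  define c where "c = integral\<^sup>L lborel g"
  have "c > 0"
  proof -
    \<comment> \<open>a crude bound of the integrand on \<open>[1,2]\<close> shows that the constant is
        positive\<close>
    have "integrable lborel (\<lambda>u::real. indicator {1..2} u * (1 / 6 :: real))"
      by simp
    then have "(LBINT u::real. indicator {1..2} u * (1 / 6 :: real)) \<le> c"
      unfolding c_def using g_int
    proof (rule integral_mono)
      fix u :: real
      show "indicator {1..2} u * (1 / 6) \<le> g u"
      proof (cases "1 \<le> u \<and> u \<le> 2")
        case True
        have "1 / 2 \<le> 1 / u"
          using True by (intro divide_left_mono) auto
        also have "1 / u = u powr (-1)"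
          using True by (simp add: powr_minus_divide)
        also have "\<dots> \<le> u powr (r - 1)"
          using True r by (intro powr_mono) auto
        finally have "1 / 2 * (1 / 3) \<le> u powr (r - 1) * (1 / (1 + u))"
          using True by (intro mult_mono divide_left_mono) auto
        then show ?thesis using True by (simp add: g_def)
      next
        case False
        then show ?thesis by (auto simp: g_def indicator_def)
      qed
    qed
    then show ?thesis by simp
  qed
  moreover have "has_bochner_integral lborel
      (\<lambda>s. indicator {0<..} s * (s powr (r - 1) * (t / (t + s)))) (c * t powr r)"
    if "0 \<le> t" for t
  proof (cases "t = 0")
    case True
    then show ?thesis by (simp add: has_bochner_integral_zero)
  next
    case False
    define G where "G = (\<lambda>s. indicator {0<..} s * (s powr (r - 1) * (t / (t + s))))"
    have t: "t > 0" using that False by simp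
    have G: "G (0 + t * u) = t powr (r - 1) * g u" for u
    proof (cases "u > 0")
      case True
      have "t / (t + t * u) = 1 / (1 + u)"
        using t True nonzero_mult_divide_mult_cancel_left[of t 1 "1 + u"] by (simp add: distrib_left)
      then show ?thesis
        using t True by (simp add: G_def g_def powr_mult mult.assoc del: times_divide_eq_right)
    next
      case False
      then show ?thesis
        using t by (simp add: G_def g_def zero_less_mult_iff)
    qed
    have "integrable lborel G"
      using lborel_integrable_real_affine_iff[of t G 0] t g_int unfolding G by simp
    moreover have "integral\<^sup>L lborel G = c * t powr r"
    proof -
      have "integral\<^sup>L lborel G = t * (t powr (r - 1) * c)"
        using lborel_integral_real_affine[of t G 0] t unfolding G by (simp add: c_def)
      moreover have "t * t powr (r - 1) = t powr r"
        using t powr_add[of t 1 "r - 1"] by simp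
      ultimately show ?thesis by (simp add: mult_ac)
    qed
    ultimately show ?thesis
      by (simp add: has_bochner_integral_iff G_def)
  qed
  ultimately show ?thesis using that by blast
qed

text \<open>
  The coefficients may have any sign, since the inequality is integrated as a whole against the
  positive density \<open>s powr (r - 1)\<close>.
\<close>

lemma sum_powr_le_of_resolvent:
  fixes \<alpha> :: "'a \<Rightarrow> real" and \<beta> :: "'b \<Rightarrow> real"
  assumes r: "0 < r" "r < 1"
    and t: "\<And>i. i \<in> I \<Longrightarrow> 0 \<le> t i" and x: "\<And>j. j \<in> J \<Longrightarrow> 0 \<le> x j"
    and le: "\<And>s. 0 < s \<Longrightarrow> (\<Sum>j\<in>J. \<beta> j * (x j / (x j + s))) \<le> (\<Sum>i\<in>I. \<alpha> i * (t i / (t i + s)))"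
  shows "(\<Sum>j\<in>J. \<beta> j * x j powr r) \<le> (\<Sum>i\<in>I. \<alpha> i * t i powr r)"
proof -
  obtain c where c: "c > 0" and int: "\<And>t. 0 \<le> t \<Longrightarrow> has_bochner_integral lborel
        (\<lambda>s. indicator {0<..} s * (s powr (r - 1) * (t / (t + s)))) (c * t powr r)"
    using powr_resolvent_integral[OF r] by blast
  let ?F = "\<lambda>t s. indicator {0<..} s * (s powr (r - 1) * (t / (t + s))) :: real"
  have 1: "has_bochner_integral lborel (\<lambda>s. \<Sum>j\<in>J. \<beta> j * ?F (x j) s) (\<Sum>j\<in>J. \<beta> j * (c * x j powr r))"
    using x int by (intro has_bochner_integral_sum has_bochner_integral_mult_right) auto
  have 2: "has_bochner_integral lborel (\<lambda>s. \<Sum>i\<in>I. \<alpha> i * ?F (t i) s) (\<Sum>i\<in>I. \<alpha> i * (c * t i powr r))"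
    using t int by (intro has_bochner_integral_sum has_bochner_integral_mult_right) auto
  have "(\<Sum>j\<in>J. \<beta> j * ?F (x j) s) \<le> (\<Sum>i\<in>I. \<alpha> i * ?F (t i) s)" for s
  proof (cases "s > 0")
    case True
    have "s powr (r - 1) * (\<Sum>j\<in>J. \<beta> j * (x j / (x j + s)))
       \<le> s powr (r - 1) * (\<Sum>i\<in>I. \<alpha> i * (t i / (t i + s)))"
      using le[OF True] by (intro mult_left_mono) auto
    then show ?thesis
      using True by (simp add: sum_distrib_left mult_ac)
  qed simp
  then have "(\<Sum>j\<in>J. \<beta> j * (c * x j powr r)) \<le> (\<Sum>i\<in>I. \<alpha> i * (c * t i powr r))"
    using 1 2 by (metis (mono_tags, lifting) has_bochner_integral_iff integral_mono)
  then have "c * (\<Sum>j\<in>J. \<beta> j * x j powr r) \<le> c * (\<Sum>i\<in>I. \<alpha> i * t i powr r)"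
    by (simp add: sum_distrib_left mult_ac)
  then show ?thesis
    using c by simp
qed

section \<open>Weighted traces of compressions by expansive matrices\<close>

definition weighted_trace :: "('n \<Rightarrow> real) \<Rightarrow> complex ^ 'n ^ 'n \<Rightarrow> real" where
  "weighted_trace w A = (\<Sum>j\<in>UNIV. w j * Re (A $ j $ j))"

lemma weighted_trace_sum: "weighted_trace w (\<Sum>i\<in>I. A i) = (\<Sum>i\<in>I. weighted_trace w (A i))"
  unfolding weighted_trace_def by (simp add: sum_distrib_left) (rule sum.swap)

lemma weighted_trace_mono:
  assumes "\<And>j. 0 \<le> w j" and "psd (B - A)"
  shows "weighted_trace w A \<le> weighted_trace w B"
  unfolding weighted_trace_def
proof (intro sum_mono mult_left_mono assms)
  show "Re (A $ j $ j) \<le> Re (B $ j $ j)" for j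
    using psd_diag_nonneg[OF assms(2), of j] by simp
qed

text \<open>
  Both sides are sums of \<open>\<bar>Q\<^sub>a\<^sub>b\<bar>\<^sup>2\<close> with coefficients \<open>w\<^sub>a h\<^sub>a\<close> and \<open>w\<^sub>a h\<^sub>b\<close>.  As \<open>\<bar>Q\<^sub>a\<^sub>b\<bar>\<close> is
  symmetric, twice their difference has the coefficients \<open>(w\<^sub>a - w\<^sub>b) (h\<^sub>b - h\<^sub>a)\<close>.
\<close>

lemma weighted_trace_rearrangement:
  assumes herm: "adjoint_mat Q = Q" and wh: "\<And>a b. 0 \<le> (w a - w b) * (h b - h a)"
  shows "weighted_trace (\<lambda>j. w j * h j) (Q ** Q) \<le> weighted_trace w (Q ** real_diag h ** Q)"
proof -
  have Q: "Q $ b $ a = cnj (Q $ a $ b)" for a b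
    by (metis herm adjoint_nth)
  define N where "N a b = (cmod (Q $ a $ b))\<^sup>2" for a b
  have N_sym: "N a b = N b a" for a b
    unfolding N_def Q[of a b] by simp
  have sq: "Re (Q $ a $ b * Q $ b $ a) = N a b" for a b
    unfolding N_def Q[of b a] cmod_power2 by (simp add: power2_eq_square)
  have 1: "weighted_trace (\<lambda>j. w j * h j) (Q ** Q) = (\<Sum>a\<in>UNIV. \<Sum>b\<in>UNIV. w a * h a * N a b)"
    unfolding weighted_trace_def
    by (simp add: matrix_matrix_mult_def sum_distrib_left sq del: times_complex.sel)
  have 2: "weighted_trace w (Q ** real_diag h ** Q) = (\<Sum>a\<in>UNIV. \<Sum>b\<in>UNIV. w a * h b * N a b)"
  proof -
    have "Re ((Q ** real_diag h ** Q) $ a $ a) = (\<Sum>b\<in>UNIV. h b * N a b)" for a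
    proof -
      have "(Q ** real_diag h ** Q) $ a $ a
          = (\<Sum>b\<in>UNIV. Q $ a $ b * complex_of_real (h b) * Q $ b $ a)"
        by (simp add: matrix_matrix_mult_def[of "Q ** real_diag h"] real_diag_mult_right)
      also have "\<dots> = (\<Sum>b\<in>UNIV. complex_of_real (h b) * (Q $ a $ b * Q $ b $ a))"
        by (simp add: mult_ac)
      moreover have "Re (complex_of_real t * z) = t * Re z" for t z
        by simp
      ultimately show ?thesis
        using sq by (simp del: times_complex.sel)
    qed
    then show ?thesis
      unfolding weighted_trace_def by (simp add: sum_distrib_left mult_ac)
  qed
  define D where "D = (\<Sum>a\<in>UNIV. \<Sum>b\<in>UNIV. w a * (h b - h a) * N a b)"
  have "D = (\<Sum>b\<in>UNIV. \<Sum>a\<in>UNIV. w b * (h a - h b) * N a b)"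
    unfolding D_def using N_sym by simp
  also have "\<dots> = (\<Sum>a\<in>UNIV. \<Sum>b\<in>UNIV. w b * (h a - h b) * N a b)"
    by (rule sum.swap)
  finally have "D + D = (\<Sum>a\<in>UNIV. \<Sum>b\<in>UNIV. w a * (h b - h a) * N a b)
      + (\<Sum>a\<in>UNIV. \<Sum>b\<in>UNIV. w b * (h a - h b) * N a b)"
    unfolding D_def by (rule arg_cong2[of _ _ _ _ "(+)", OF refl])
  also have "\<dots> = (\<Sum>a\<in>UNIV. \<Sum>b\<in>UNIV. (w a - w b) * (h b - h a) * N a b)"
    by (simp add: sum.distrib[symmetric] algebra_simps)
  also have "\<dots> \<ge> 0"
    by (intro sum_nonneg mult_nonneg_nonneg[OF wh]) (simp add: N_def)
  finally have "0 \<le> D" by simp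
  then show ?thesis
    unfolding 1 2 D_def by (simp add: algebra_simps sum_subtractf)
qed

text \<open>
  With the polar decomposition \<open>Z = U Q\<close> one has \<open>Z* Z = Q Q\<close> and \<open>Z Z* = U Q Q U*\<close>.
\<close>

lemma expansive_adjoint:
  assumes "expansive Z"
  shows "psd (Z ** adjoint_mat Z - mat 1)"
proof -
  obtain U Q where U: "unitary_mat U" and Q: "psd Q" and Z: "Z = U ** Q"
    by (rule polar_decomposition)
  have herm: "adjoint_mat Q = Q"
    using Q by (simp add: psd_iff)
  have "psd (Q ** Q - mat 1)"
    using assms U by (simp add: expansive_def Z adjoint_mult herm matrix_mul_assoc[symmetric] unitaryD)
  then have "psd (adjoint_mat (adjoint_mat U) ** (Q ** Q - mat 1) ** adjoint_mat U)"
    by (rule psd_conj)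
  then show ?thesis
    using U by (simp add: Z adjoint_mult herm matrix_distribs matrix_mul_assoc[symmetric] unitaryD)
qed

lemma real_diag_add: "real_diag d + real_diag d' = real_diag (\<lambda>i. d i + d' i)"
  by (simp add: real_diag_def vec_eq_iff)

lemma unitary_diag_mult:
  assumes "unitary_mat U"
  shows "(U ** real_diag d ** adjoint_mat U) ** (U ** real_diag d' ** adjoint_mat U)
       = U ** real_diag (\<lambda>i. d i * d' i) ** adjoint_mat U"
proof -
  have "(U ** real_diag d ** adjoint_mat U) ** (U ** real_diag d' ** adjoint_mat U)
      = U ** (real_diag d ** real_diag d') ** adjoint_mat U"
    using assms by (simp add: matrix_mul_assoc[symmetric] unitaryD)
  then show ?thesis
    by (simp add: real_diag_mult_diag)
qed

text \<open>
  With \<open>B = U (diag b) U*\<close> and the polar decomposition \<open>B\<^sup>1\<^sup>/\<^sup>2 Y = W Q\<close>, one has \<open>T = Q Q\<close> and the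
  compression on the right is \<open>F = (W Q)* (B + s)\<^sup>-\<^sup>1 (W Q)\<close>.  Let \<open>H\<close> be the resolvent
  \<open>(diag x + s)\<^sup>-\<^sup>1\<close>.  The lower bound \<open>F \<ge> (W Q)* K + K* (W Q) - K* (B + s) K\<close> at
  \<open>K = W H Q\<close>, together with \<open>Y Y* \<ge> 1\<close> and \<open>T \<le> diag x\<close>, collapses to \<open>F \<ge> Q H Q\<close>.  In the
  weighted trace \<open>Q H Q\<close> may be replaced by \<open>H Q Q\<close>, because the entries of \<open>H\<close> increase
  along \<open>e\<close> while the weights decrease.  The choice of \<open>K\<close> merges two steps, the passage from \<open>B\<close> to
  \<open>T\<close> and the one from \<open>T\<close> to \<open>diag x\<close>, into a single completed square.
\<close>

lemma resolvent_compression: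
  fixes U Y :: "complex ^ 'n ^ 'n" and b x w :: "'n \<Rightarrow> real"
  assumes U: "unitary_mat U" and b: "\<And>i. 0 \<le> b i" and s: "0 < s"
    and Y: "psd (Y ** adjoint_mat Y - mat 1)"
    and T: "T = adjoint_mat Y ** (U ** real_diag b ** adjoint_mat U) ** Y"
    and Tx: "psd (real_diag x - T)"
    and x: "\<And>i. 0 \<le> x i" "decreasing_along e x"
    and w: "\<And>i. 0 \<le> w i" "decreasing_along e w"
  shows "weighted_trace (\<lambda>j. w j * (1 / (x j + s))) T
       \<le> weighted_trace w
           (adjoint_mat Y ** (U ** real_diag (\<lambda>i. b i / (b i + s)) ** adjoint_mat U) ** Y)"
proof -
  define spec where "spec d = U ** real_diag d ** adjoint_mat U" for d
  have spec_mult: "spec d ** spec d' = spec (\<lambda>i. d i * d' i)" for d d'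
    unfolding spec_def by (rule unitary_diag_mult[OF U])
  have spec_adj: "adjoint_mat (spec d) = spec d" for d
    by (simp add: spec_def adjoint_mult matrix_mul_assoc)
  have pos: "b i + s \<noteq> 0" "x i + s \<noteq> 0" for i
    using b[of i] x(1)[of i] s by linarith+
  define G where "G = spec (\<lambda>i. sqrt (b i))"
  define L where "L = spec (\<lambda>i. b i + s)"
  define R where "R = spec (\<lambda>i. 1 / (b i + s))"
  define h where "h = (\<lambda>j. 1 / (x j + s))"
  define H :: "complex ^ 'n ^ 'n" where "H = real_diag h"
  have GG: "G ** G = spec b"
    using b by (simp add: G_def spec_mult)
  have GRG: "G ** (R ** G) = spec (\<lambda>i. b i / (b i + s))"
    using b by (simp add: G_def R_def spec_mult mult_ac)
  have "spec (\<lambda>i. 1) = mat 1"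
    using U by (simp add: spec_def real_diag_1 unitaryD)
  then have RL: "R ** L = mat 1" "L ** R = mat 1"
    using pos by (simp_all add: L_def R_def spec_mult)
  obtain W Q where W: "unitary_mat W" and "psd Q" and C: "G ** Y = W ** Q"
    by (rule polar_decomposition)
  then have Q: "adjoint_mat Q = Q"
    by (simp add: psd_iff)
  have C': "adjoint_mat Y ** G = Q ** adjoint_mat W"
    using arg_cong[OF C, of adjoint_mat] by (simp add: adjoint_mult Q G_def spec_adj)
  have TQ: "T = Q ** Q"
  proof -
    have "T = (adjoint_mat Y ** G) ** (G ** Y)"
      by (simp add: T GG[symmetric] spec_def[symmetric] matrix_mul_assoc)
    then show ?thesis
      using W by (simp add: C C' matrix_mul_assoc[symmetric] unitaryD)
  qed
  \<comment> \<open>the square in \<open>P1\<close> vanishes at \<open>K = R W Q\<close>; here the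
      resolvent \<open>R\<close> of \<open>B\<close> gives way to the resolvent \<open>H\<close> of
      \<open>diag x\<close>, placed behind \<open>W\<close>\<close>
  define K where "K = W ** (H ** Q)"
  have K': "adjoint_mat K = Q ** (H ** adjoint_mat W)"
    by (simp add: K_def adjoint_mult Q H_def matrix_mul_assoc)
  define F where "F = adjoint_mat Y ** (spec (\<lambda>i. b i / (b i + s)) ** Y)"
  \<comment> \<open>the completed square \<open>(W Q - L K)* R (W Q - L K)\<close>, where
      \<open>R\<close> is the inverse of \<open>L = B + s\<close>\<close>
  have P1: "psd (F - Q ** (H ** Q) - Q ** (H ** Q) + adjoint_mat K ** (L ** K))"
  proof -
    have "psd R"
      using psd_conj[OF psd_real_diag, of "\<lambda>i. 1 / (b i + s)" "adjoint_mat U"] b s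
      by (simp add: R_def spec_def add_nonneg_nonneg)
    then have "psd (adjoint_mat (W ** Q - L ** K) ** R ** (W ** Q - L ** K))"
      by (rule psd_conj)
    also have "adjoint_mat (W ** Q - L ** K) ** R ** (W ** Q - L ** K)
        = adjoint_mat (W ** Q) ** (R ** (W ** Q)) - adjoint_mat (W ** Q) ** ((R ** L) ** K)
          - adjoint_mat K ** ((L ** R) ** (W ** Q)) + adjoint_mat K ** (L ** ((R ** L) ** K))"
      by (simp add: adjoint_diff adjoint_mult[of L] spec_adj L_def[symmetric] matrix_distribs
          matrix_mul_assoc[symmetric] spec_adj[of "\<lambda>i. b i + s", folded L_def])
    also have "adjoint_mat (W ** Q) ** (R ** (W ** Q)) = F"
    proof -
      have "adjoint_mat (W ** Q) ** (R ** (W ** Q)) = adjoint_mat Y ** ((G ** (R ** G)) ** Y)"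
        unfolding C[symmetric] by (simp add: adjoint_mult G_def spec_adj matrix_mul_assoc)
      then show ?thesis by (simp add: GRG F_def)
    qed
    also have "adjoint_mat (W ** Q) ** ((R ** L) ** K) = Q ** (H ** Q)"
      using W by (simp add: RL K_def adjoint_mult Q matrix_mul_assoc[symmetric] unitaryD)
    also have "adjoint_mat K ** ((L ** R) ** (W ** Q)) = Q ** (H ** Q)"
      using W by (simp add: RL K' matrix_mul_assoc[symmetric] unitaryD)
    finally show ?thesis by (simp add: RL)
  qed
  \<comment> \<open>this uses \<open>B\<^sup>1\<^sup>/\<^sup>2 Y Y* B\<^sup>1\<^sup>/\<^sup>2 \<ge>
      B\<close>\<close>
  have P2: "psd (Q ** (H ** (T ** (H ** Q))) - adjoint_mat K ** (spec b ** K))"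
  proof -
    have "psd (adjoint_mat (G ** K) ** (Y ** adjoint_mat Y - mat 1) ** (G ** K))"
      using Y by (rule psd_conj)
    also have "adjoint_mat (G ** K) ** (Y ** adjoint_mat Y - mat 1) ** (G ** K)
        = adjoint_mat K ** ((G ** Y) ** ((adjoint_mat Y ** G) ** K)) - adjoint_mat K ** ((G ** G) ** K)"
      by (simp add: adjoint_mult[of G] spec_adj[of "\<lambda>i. sqrt (b i)", folded G_def] matrix_distribs
          matrix_mul_assoc)
    also have "adjoint_mat K ** ((G ** Y) ** ((adjoint_mat Y ** G) ** K)) = Q ** (H ** (T ** (H ** Q)))"
      unfolding C C' K' unfolding K_def TQ using W by (simp add: matrix_mul_assoc[symmetric] unitaryD)
    finally show ?thesis by (simp add: GG)
  qed
  \<comment> \<open>this uses \<open>T \<le> diag x\<close>\<close>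
  have P3: "psd (Q ** (H ** (real_diag x ** (H ** Q))) - Q ** (H ** (T ** (H ** Q))))"
    using psd_conj[OF Tx, of "H ** Q"]
    by (simp add: adjoint_mult Q H_def matrix_distribs matrix_mul_assoc)
  have LK: "adjoint_mat K ** (L ** K)
      = adjoint_mat K ** (spec b ** K) + Q ** (H ** (real_diag (\<lambda>i. s) ** (H ** Q)))"
  proof -
    have "real_diag (\<lambda>i. b i + s) = real_diag b + (real_diag (\<lambda>i. s) :: complex ^ 'n ^ 'n)"
      by (simp add: real_diag_add)
    moreover have comm: "real_diag (\<lambda>i. s) ** X = X ** real_diag (\<lambda>i. s)" for X :: "complex ^ 'n ^ 'n"
      by (simp add: vec_eq_iff real_diag_mult_left real_diag_mult_right)
    moreover have "U ** real_diag (\<lambda>i. s) ** adjoint_mat U = real_diag (\<lambda>i. s)"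
      unfolding comm[symmetric] using U by (simp add: matrix_mul_assoc[symmetric] unitaryD)
    ultimately have "L = spec b + real_diag (\<lambda>i. s)"
      by (simp add: L_def spec_def matrix_distribs)
    moreover have "adjoint_mat K ** (real_diag (\<lambda>i. s) ** K)
        = Q ** (H ** (real_diag (\<lambda>i. s) ** (H ** Q)))"
    proof -
      have "real_diag (\<lambda>i. s) ** K = W ** (real_diag (\<lambda>i. s) ** (H ** Q))"
        by (simp only: K_def matrix_mul_assoc comm[of W])
      then show ?thesis
        using W by (simp add: K' matrix_mul_assoc[symmetric] unitaryD)
    qed
    ultimately show ?thesis
      by (simp add: matrix_distribs)
  qed
  have HxH: "Q ** (H ** (real_diag x ** (H ** Q))) + Q ** (H ** (real_diag (\<lambda>i. s) ** (H ** Q)))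
      = Q ** (H ** Q)"
  proof -
    have "H ** (real_diag x ** H) + H ** (real_diag (\<lambda>i. s) ** H) = H"
    proof -
      have "h i * (x i * h i) + h i * (s * h i) = h i" for i
      proof -
        have "h i * (x i * h i) + h i * (s * h i) = h i * (h i * (x i + s))"
          by (simp add: algebra_simps)
        then show ?thesis
          using pos by (simp add: h_def)
      qed
      then show ?thesis
        by (simp add: H_def real_diag_mult_diag real_diag_add)
    qed
    then have "Q ** ((H ** (real_diag x ** H) + H ** (real_diag (\<lambda>i. s) ** H)) ** Q) = Q ** (H ** Q)"
      by simp
    then show ?thesis
      by (simp add: matrix_distribs matrix_mul_assoc)
  qed
  have "psd (F - Q ** (H ** Q))"
    using psd_add[OF psd_add[OF P1 P2] P3] unfolding LK
    by (simp add: algebra_simps HxH[symmetric])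
  then have "weighted_trace w (Q ** H ** Q) \<le> weighted_trace w F"
    using w(1) by (intro weighted_trace_mono) (simp_all add: matrix_mul_assoc)
  moreover have "weighted_trace (\<lambda>j. w j * h j) (Q ** Q) \<le> weighted_trace w (Q ** H ** Q)"
    unfolding H_def
  proof (rule weighted_trace_rearrangement[OF Q])
    fix a c
    have ac: "0 \<le> (w a - w c) * (h c - h a)" if "e a \<le> e c" for a c
    proof -
      have "h a \<le> h c"
        using x that s unfolding decreasing_along_def h_def
        by (intro divide_left_mono mult_pos_pos add_nonneg_pos) auto
      moreover have "w c \<le> w a"
        using w(2) that unfolding decreasing_along_def by simp
      ultimately show ?thesis by simp
    qed
    show "0 \<le> (w a - w c) * (h c - h a)"
      using ac[of a c] ac[of c a] by (cases "e a \<le> e c") (simp_all add: algebra_simps)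
  qed
  ultimately show ?thesis
    by (simp add: TQ h_def F_def spec_def matrix_mul_assoc)
qed

lemma conj_diag_nth:
  "(adjoint_mat W ** real_diag d ** W) $ j $ j
     = complex_of_real (\<Sum>k\<in>UNIV. (cmod (W $ k $ j))\<^sup>2 * d k)"
  by (simp add: matrix_matrix_mult_def[of "adjoint_mat W ** real_diag d"] real_diag_mult_right
      complex_norm_square mult_ac del: of_real_power)

lemma weighted_trace_conj_diag:
  "weighted_trace w (adjoint_mat W ** real_diag d ** W)
     = (\<Sum>j\<in>UNIV. \<Sum>k\<in>UNIV. (w j * (cmod (W $ k $ j))\<^sup>2) * d k)"
  by (simp add: weighted_trace_def conj_diag_nth sum_distrib_left mult_ac)

text \<open>
  The bounds of \<open>resolvent_compression\<close> add up, over \<open>i\<close>, to the statement with \<open>t/(t + s)\<close> in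
  place of \<open>t powr r\<close>, because the compressions \<open>T i\<close> of the individual summands add up to \<open>diag x\<close>.
  Both sides are linear combinations of values of this function with coefficients that do not
  depend on \<open>s\<close>, so one may integrate over \<open>s\<close>.
\<close>

lemma weighted_trace_powr_compression:
  fixes U Z :: "'i \<Rightarrow> complex ^ 'n ^ 'n" and b :: "'i \<Rightarrow> 'n \<Rightarrow> real"
  assumes r: "0 < r" "r < 1" and I: "finite I"
    and U: "\<And>i. i \<in> I \<Longrightarrow> unitary_mat (U i)" and b: "\<And>i k. i \<in> I \<Longrightarrow> 0 \<le> b i k"
    and Z: "\<And>i. i \<in> I \<Longrightarrow> expansive (Z i)" and V: "unitary_mat V"
    and X: "(\<Sum>i\<in>I. adjoint_mat (Z i) ** (U i ** real_diag (b i) ** adjoint_mat (U i)) ** Z i)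
          = V ** real_diag x ** adjoint_mat V"
    and x: "\<And>i. 0 \<le> x i" "decreasing_along e x"
    and w: "\<And>i. 0 \<le> w i" "decreasing_along e w"
  shows "(\<Sum>j\<in>UNIV. w j * x j powr r)
       \<le> weighted_trace w (adjoint_mat V ** (\<Sum>i\<in>I. adjoint_mat (Z i)
            ** (U i ** real_diag (\<lambda>k. b i k powr r) ** adjoint_mat (U i)) ** Z i) ** V)"
proof -
  define Y where "Y i = Z i ** V" for i
  define W where "W i = adjoint_mat (U i) ** Y i" for i
  define T where "T i = adjoint_mat (Y i) ** (U i ** real_diag (b i) ** adjoint_mat (U i)) ** Y i" for i
  have sumT: "(\<Sum>i\<in>I. T i) = real_diag x"
  proof -
    have "(\<Sum>i\<in>I. T i) = adjoint_mat V ** (\<Sum>i\<in>I. adjoint_mat (Z i)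
            ** (U i ** real_diag (b i) ** adjoint_mat (U i)) ** Z i) ** V"
      by (simp add: T_def Y_def adjoint_mult matrix_sum_ldistrib matrix_sum_rdistrib matrix_mul_assoc)
    also have "\<dots> = real_diag x"
      unfolding X using V by (simp add: matrix_mul_assoc[symmetric] unitaryD)
    finally show ?thesis .
  qed
  have T_psd: "psd (T i)" if "i \<in> I" for i
    using psd_conj[OF psd_real_diag[OF b[OF that]], of "W i"]
    by (simp add: T_def W_def adjoint_mult matrix_mul_assoc)
  have val: "weighted_trace w (adjoint_mat (Y i) ** (U i ** real_diag d ** adjoint_mat (U i)) ** Y i)
      = (\<Sum>j\<in>UNIV. \<Sum>k\<in>UNIV. (w j * (cmod (W i $ k $ j))\<^sup>2) * d k)" for i d
    using weighted_trace_conj_diag[of w "W i" d] by (simp add: W_def adjoint_mult matrix_mul_assoc)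
  have res: "(\<Sum>j\<in>UNIV. w j * (x j / (x j + s)))
     \<le> (\<Sum>(i, j, k)\<in>I \<times> UNIV \<times> UNIV. (w j * (cmod (W i $ k $ j))\<^sup>2) * (b i k / (b i k + s)))"
    if s: "0 < s" for s
  proof -
    have "(\<Sum>j\<in>UNIV. w j * (x j / (x j + s))) = weighted_trace (\<lambda>j. w j * (1 / (x j + s))) (real_diag x)"
      by (simp add: weighted_trace_def real_diag_def)
    also have "\<dots> = (\<Sum>i\<in>I. weighted_trace (\<lambda>j. w j * (1 / (x j + s))) (T i))"
      unfolding sumT[symmetric] by (rule weighted_trace_sum)
    also have "\<dots> \<le> (\<Sum>i\<in>I. weighted_trace w (adjoint_mat (Y i)
          ** (U i ** real_diag (\<lambda>k. b i k / (b i k + s)) ** adjoint_mat (U i)) ** Y i))"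
    proof (rule sum_mono)
      fix i assume i: "i \<in> I"
      \<comment> \<open>the compressions are positive semidefinite and add up to \<open>diag x\<close>,
          so each of them lies below it\<close>
      have "real_diag x - T i = (\<Sum>k\<in>I - {i}. T k)"
        unfolding sumT[symmetric] using I i by (simp add: sum_diff1)
      then have Tx: "psd (real_diag x - T i)"
        using T_psd by (auto intro: psd_sum)
      have Y: "psd (Y i ** adjoint_mat (Y i) - mat 1)"
        using expansive_adjoint[OF Z[OF i]] V
        by (simp add: Y_def adjoint_mult matrix_mul_assoc[symmetric] unitaryD)
      show "weighted_trace (\<lambda>j. w j * (1 / (x j + s))) (T i)
          \<le> weighted_trace w (adjoint_mat (Y i)
              ** (U i ** real_diag (\<lambda>k. b i k / (b i k + s)) ** adjoint_mat (U i)) ** Y i)"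
        by (rule resolvent_compression[OF U[OF i] b[OF i] s Y T_def Tx x w])
    qed
    finally show ?thesis
      unfolding val by (simp add: sum.cartesian_product)
  qed
  have "(\<Sum>j\<in>UNIV. w j * x j powr r)
     \<le> (\<Sum>(i, j, k)\<in>I \<times> UNIV \<times> UNIV. (w j * (cmod (W i $ k $ j))\<^sup>2) * b i k powr r)"
    using sum_powr_le_of_resolvent[OF r, of "I \<times> UNIV \<times> UNIV" "\<lambda>(i, j, k). b i k" UNIV x w
        "\<lambda>(i, j, k). w j * (cmod (W i $ k $ j))\<^sup>2"] b x(1) res
    by (auto simp: case_prod_unfold)
  also have "\<dots> = (\<Sum>i\<in>I. weighted_trace w (adjoint_mat (Y i)
        ** (U i ** real_diag (\<lambda>k. b i k powr r) ** adjoint_mat (U i)) ** Y i))"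
    unfolding val by (simp add: sum.cartesian_product)
  also have "\<dots> = weighted_trace w (adjoint_mat V ** (\<Sum>i\<in>I. adjoint_mat (Z i)
            ** (U i ** real_diag (\<lambda>k. b i k powr r) ** adjoint_mat (U i)) ** Z i) ** V)"
    unfolding weighted_trace_sum[symmetric]
    by (simp add: Y_def adjoint_mult matrix_sum_ldistrib matrix_sum_rdistrib matrix_mul_assoc)
  finally show ?thesis .
qed

section \<open>Weak majorization and powers\<close>

text \<open>
  The tangent line inequality for the convex function \<open>t powr p\<close>, including the end point \<open>0\<close>; it is
  Young's inequality for \<open>b\<close> and \<open>a powr (p - 1)\<close>.
\<close>

lemma powr_ge_tangent:
  fixes a b p :: real
  assumes p: "1 < p" and "0 \<le> a" "0 \<le> b"
  shows "a powr p + p * a powr (p - 1) * (b - a) \<le> b powr p"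
proof -
  define q where "q = p / (p - 1)"
  have q: "q > 1" "1 / p + 1 / q = 1" "(p - 1) * q = p"
    using p by (simp_all add: q_def field_simps)
  have "b * a powr (p - 1) \<le> b powr p / p + (a powr (p - 1)) powr q / q"
    using assms q by (intro Youngs_inequality) auto
  also have "(a powr (p - 1)) powr q = a powr p"
    by (simp add: powr_powr q(3))
  finally have "p * (b * a powr (p - 1)) \<le> p * (b powr p / p + a powr p / q)"
    using p by (intro mult_left_mono) auto
  also have "\<dots> = b powr p + (p - 1) * a powr p"
    using p by (simp add: q_def field_simps)
  finally have "p * (b * a powr (p - 1)) \<le> b powr p + (p - 1) * a powr p" .
  moreover have "a * a powr (p - 1) = a powr p"
    using assms powr_add[of a 1 "p - 1"] by (cases "a = 0") auto
  ultimately show ?thesis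
    by (simp add: algebra_simps)
qed

text \<open>
  The tangent to \<open>t powr p\<close> at \<open>\<xi> j = x j powr (1/p)\<close> bounds \<open>s j powr p - x j\<close> below by
  \<open>p * \<xi> j powr (p - 1) * (s j - \<xi> j)\<close>.  As \<open>c\<close> and \<open>\<xi>\<close> are decreasing, the resulting weights are
  again admissible in the hypothesis.
\<close>

lemma weak_majorization_powr:
  fixes x s :: "'n :: finite \<Rightarrow> real"
  assumes p: "1 < p" and x: "\<And>i. 0 \<le> x i" "decreasing_along e x" and s: "\<And>i. 0 \<le> s i"
    and c: "\<And>i. 0 \<le> c i" "decreasing_along e c"
    and major: "\<And>w. (\<And>i. 0 \<le> w i) \<Longrightarrow> decreasing_along e w \<Longrightarrow>
        (\<Sum>j\<in>UNIV. w j * x j powr (1 / p)) \<le> (\<Sum>j\<in>UNIV. w j * s j)"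
  shows "(\<Sum>j\<in>UNIV. c j * x j) \<le> (\<Sum>j\<in>UNIV. c j * s j powr p)"
proof -
  define \<xi> where "\<xi> j = x j powr (1 / p)" for j
  define w where "w j = c j * (p * \<xi> j powr (p - 1))" for j
  have "(\<Sum>j\<in>UNIV. w j * \<xi> j) \<le> (\<Sum>j\<in>UNIV. w j * s j)"
    unfolding \<xi>_def
  proof (rule major)
    show "0 \<le> w i" for i
      using c(1) p by (simp add: w_def)
    show "decreasing_along e w"
      unfolding decreasing_along_def
    proof (intro allI impI)
      fix i j assume ij: "e i \<le> e j"
      have "\<xi> j \<le> \<xi> i"
        using x p ij unfolding \<xi>_def decreasing_along_def by (intro powr_mono2) auto
      then have "\<xi> j powr (p - 1) \<le> \<xi> i powr (p - 1)"
        using p by (intro powr_mono2) (auto simp: \<xi>_def)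
      then show "w j \<le> w i"
        unfolding w_def using c p ij
        by (intro mult_mono) (auto simp: decreasing_along_def)
    qed
  qed
  then have "0 \<le> (\<Sum>j\<in>UNIV. c j * (p * \<xi> j powr (p - 1) * (s j - \<xi> j)))"
    by (simp add: w_def algebra_simps sum_subtractf)
  also have "\<dots> \<le> (\<Sum>j\<in>UNIV. c j * (s j powr p - x j))"
  proof (intro sum_mono mult_left_mono c(1))
    fix j
    have "\<xi> j powr p = x j"
      using p x(1)[of j] by (simp add: \<xi>_def powr_powr)
    then show "p * \<xi> j powr (p - 1) * (s j - \<xi> j) \<le> s j powr p - x j"
      using powr_ge_tangent[OF p, of "\<xi> j" "s j"] s[of j] by (simp add: \<xi>_def)
  qed
  finally show ?thesis
    by (simp add: right_diff_distrib sum_subtractf)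
qed

section \<open>Symmetric norms and weak majorization\<close>

lemma symmetric_norm_unitary:
  assumes "symmetric_norm N" "unitary_mat U" "unitary_mat V"
  shows "N (U ** A ** V) = N A"
  using assms by (simp add: symmetric_norm_def)

lemma symmetric_norm_triangle: "symmetric_norm N \<Longrightarrow> N (A + B) \<le> N A + N B"
  by (simp add: symmetric_norm_def)

lemma symmetric_norm_scaleR:
  assumes "symmetric_norm N"
  shows "N (t *\<^sub>R A) = \<bar>t\<bar> * N A"
proof -
  have "t *\<^sub>R A = map_matrix (\<lambda>z. complex_of_real t * z) A"
    by (simp add: vec_eq_iff scaleR_conv_of_real[where 'a = complex])
  then show ?thesis
    using assms by (simp add: symmetric_norm_def)
qed

lemma convex_symmetric_norm_ball:
  assumes "symmetric_norm N"
  shows "convex {A. N A \<le> t}"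
proof (rule convexI, clarify)
  fix A B and u v :: real
  assume AB: "N A \<le> t" "N B \<le> t" and uv: "0 \<le> u" "0 \<le> v" "u + v = 1"
  have "N (u *\<^sub>R A + v *\<^sub>R B) \<le> N (u *\<^sub>R A) + N (v *\<^sub>R B)"
    by (rule symmetric_norm_triangle[OF assms])
  also have "\<dots> = u * N A + v * N B"
    using uv by (simp add: symmetric_norm_scaleR[OF assms])
  also have "\<dots> \<le> u * t + v * t"
    using AB uv by (intro add_mono mult_left_mono) auto
  also have "\<dots> = t"
    using uv by (simp add: distrib_right[symmetric])
  finally show "N (u *\<^sub>R A + v *\<^sub>R B) \<le> t" .
qed

definition diagonal_part :: "complex ^ 'n ^ 'n \<Rightarrow> complex ^ 'n ^ 'n" where
  "diagonal_part A = (\<chi> i j. if i = j then A $ i $ j else 0)"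

text \<open>
  Conjugation by the reflection in one coordinate \<open>k\<close> changes the sign of the off-diagonal entries in
  row and column \<open>k\<close> only, so averaging a matrix with this conjugate deletes them.  This is done
  for one index after the other.
\<close>

lemma symmetric_norm_diagonal_part_le:
  fixes A :: "complex ^ 'n ^ 'n"
  assumes N: "symmetric_norm N"
  shows "N (diagonal_part A) \<le> N A"
proof -
  define pinch :: "'n set \<Rightarrow> complex ^ 'n ^ 'n" where
    "pinch S = (\<chi> i j. if i = j \<or> (i \<notin> S \<and> j \<notin> S) then A $ i $ j else 0)" for S
  have "N (pinch S) \<le> N A" if "finite S" for S
    using that
  proof (induction S rule: finite_induct)
    case empty
    have "pinch {} = A"
      by (simp add: pinch_def vec_eq_iff)
    then show ?case by simp
  next
    case (insert k S)
    define R :: "complex ^ 'n ^ 'n" where "R = real_diag (\<lambda>i. if i = k then - 1 else 1)"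
    have R: "unitary_mat R"
      unfolding R_def by (rule unitary_real_diag_sign) simp
    have "pinch (insert k S) = (1 / 2) *\<^sub>R (pinch S + R ** pinch S ** R)"
      unfolding R_def
      by (simp add: vec_eq_iff real_diag_mult_left real_diag_mult_right)
         (auto simp: pinch_def scaleR_conv_of_real[where 'a = complex])
    then have "N (pinch (insert k S)) = N (pinch S + R ** pinch S ** R) / 2"
      by (simp add: symmetric_norm_scaleR[OF N])
    also have "\<dots> \<le> (N (pinch S) + N (R ** pinch S ** R)) / 2"
      using symmetric_norm_triangle[OF N] by (intro divide_right_mono) auto
    also have "\<dots> = N (pinch S)"
      by (simp add: symmetric_norm_unitary[OF N R R])
    finally show ?case
      using insert.IH by simp
  qed
  from this[of UNIV] show ?thesis
    by (simp add: pinch_def diagonal_part_def)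
qed

text \<open>
  The diagonal parts of all \<open>U (diag y) V\<close> with unitary \<open>U, V\<close> have norm at most that of \<open>diag y\<close>,
  and so has their convex hull.  If \<open>diag x\<close> were outside this hull, a real functional \<open>a\<close> would
  separate it.  On real diagonal matrices \<open>a\<close> is given by a vector \<open>- c\<close>.  Diagonalizing
  \<open>diag \<bar>c\<bar>\<close> with eigenvalues \<open>\<gamma>\<close> arranged along \<open>e\<close> amounts to sorting \<open>\<bar>c\<bar>\<close>, and
  \<open>\<Sum> c\<^sub>j x\<^sub>j \<le> \<Sum> \<gamma>\<^sub>j x\<^sub>j \<le> \<Sum> \<gamma>\<^sub>j y\<^sub>j\<close>, where the last sum is attained in the hull: a contradiction.
\<close>

lemma symmetric_norm_weak_majorization:
  fixes x y :: "'n :: finite \<Rightarrow> real" and e :: "'n \<Rightarrow> nat"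
  assumes N: "symmetric_norm N" and e: "bij_betw e UNIV {..<CARD('n)}"
    and x: "\<And>i. 0 \<le> x i" "decreasing_along e x"
    and major: "\<And>c. (\<And>i. 0 \<le> c i) \<Longrightarrow> decreasing_along e c \<Longrightarrow>
        (\<Sum>j\<in>UNIV. c j * x j) \<le> (\<Sum>j\<in>UNIV. c j * y j)"
  shows "N (real_diag x) \<le> N (real_diag y)"
proof -
  let ?\<U> = "{U :: complex ^ 'n ^ 'n. unitary_mat U}"
  define f :: "(complex ^ 'n ^ 'n) \<times> (complex ^ 'n ^ 'n) \<Rightarrow> complex ^ 'n ^ 'n"
    where "f = (\<lambda>P. diagonal_part (fst P ** real_diag y ** snd P))"
  define K where "K = convex hull (f ` (?\<U> \<times> ?\<U>))"
  have "continuous_on (?\<U> \<times> ?\<U>) f"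
    unfolding f_def diagonal_part_def matrix_matrix_mult_def vec_lambda_beta
  proof (intro continuous_on_vec_lambda)
    fix i j :: 'n
    let ?g = "\<lambda>P :: (complex ^ 'n ^ 'n) \<times> (complex ^ 'n ^ 'n).
      \<Sum>k\<in>UNIV. (\<Sum>l\<in>UNIV. fst P $ i $ l * real_diag y $ l $ k) * snd P $ k $ j"
    have "continuous_on (?\<U> \<times> ?\<U>) ?g"
      by (intro continuous_intros)
    then show "continuous_on (?\<U> \<times> ?\<U>) (\<lambda>P. if i = j then ?g P else 0)"
      by (cases "i = j") simp_all
  qed
  then have "compact K"
    unfolding K_def
    by (intro compact_convex_hull compact_continuous_image compact_Times compact_unitary)
  have "real_diag x \<in> K"
  proof (rule ccontr)
    assume "real_diag x \<notin> K"
    then obtain a b where ab: "a \<bullet> real_diag x < b" "\<And>A. A \<in> K \<Longrightarrow> b < a \<bullet> A"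
      using separating_hyperplane_closed_point[of K "real_diag x"] \<open>compact K\<close>
      by (auto simp: K_def compact_imp_closed)
    define c where "c j = - Re (a $ j $ j)" for j
    define \<epsilon> where "\<epsilon> j = (if 0 \<le> c j then 1 else - 1 :: real)" for j
    have inner_diag: "a \<bullet> diagonal_part A = (\<Sum>j\<in>UNIV. - c j * v j)"
      if A: "\<And>j. A $ j $ j = complex_of_real (v j)" for A v
    proof -
      have "(a $ i) \<bullet> (diagonal_part A $ i) = - c i * v i" for i
      proof -
        have "(a $ i) \<bullet> (diagonal_part A $ i) = (\<Sum>j\<in>UNIV. if i = j then - c i * v i else 0)"
          unfolding inner_vec_def
          by (rule sum.cong) (auto simp: diagonal_part_def A inner_complex_def c_def)
        then show ?thesis by simp
      qed
      then show ?thesis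
        by (simp add: inner_vec_def[of a])
    qed
    have "psd (real_diag (\<lambda>j. \<bar>c j\<bar>) :: complex ^ 'n ^ 'n)"
      by (rule psd_real_diag) simp
    then obtain P :: "complex ^ 'n ^ 'n" and \<gamma> where P: "unitary_mat P"
      and \<gamma>: "decreasing_along e \<gamma>" "\<And>i. 0 \<le> \<gamma> i"
      and cP: "real_diag (\<lambda>j. \<bar>c j\<bar>) = P ** real_diag \<gamma> ** adjoint_mat P"
      using psd_spectral_sorted bij_betw_imp_inj_on[OF e] by metis
    have \<gamma>P: "real_diag \<gamma> = adjoint_mat P ** real_diag (\<lambda>j. \<bar>c j\<bar>) ** P"
      unfolding cP using P by (simp add: matrix_mul_assoc[symmetric] unitaryD)
    have c_eq: "\<bar>c j\<bar> = (\<Sum>k\<in>UNIV. (cmod (P $ j $ k))\<^sup>2 * \<gamma> k)" for j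
    proof -
      have "complex_of_real \<bar>c j\<bar> = real_diag (\<lambda>j. \<bar>c j\<bar>) $ j $ j"
        by (simp add: real_diag_def)
      also have "\<dots> = complex_of_real (\<Sum>k\<in>UNIV. (cmod (P $ j $ k))\<^sup>2 * \<gamma> k)"
        using conj_diag_nth[of "adjoint_mat P" \<gamma> j] by (simp add: cP)
      finally show ?thesis by (simp only: of_real_eq_iff)
    qed
    have \<gamma>_eq: "\<gamma> k = (\<Sum>j\<in>UNIV. (cmod (P $ j $ k))\<^sup>2 * \<bar>c j\<bar>)" for k
    proof -
      have "complex_of_real (\<gamma> k) = real_diag \<gamma> $ k $ k"
        by (simp add: real_diag_def)
      also have "\<dots> = complex_of_real (\<Sum>j\<in>UNIV. (cmod (P $ j $ k))\<^sup>2 * \<bar>c j\<bar>)"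
        unfolding \<gamma>P by (rule conj_diag_nth)
      finally show ?thesis by (simp only: of_real_eq_iff)
    qed
    define v where "v j = (\<Sum>k\<in>UNIV. (cmod (P $ j $ k))\<^sup>2 * y k)" for j
    have "(\<Sum>j\<in>UNIV. c j * x j) \<le> (\<Sum>j\<in>UNIV. x j * \<bar>c j\<bar>)"
      using x(1) by (intro sum_mono) (metis abs_ge_self mult.commute mult_left_mono)
    also have "\<dots> \<le> (\<Sum>j\<in>UNIV. x j * \<gamma> j)"
      unfolding c_eq
      by (rule doubly_stochastic_rearrangement[OF e])
         (use x \<gamma> P in \<open>simp_all add: sum_row_unitary sum_column_unitary\<close>)
    also have "\<dots> \<le> (\<Sum>k\<in>UNIV. \<gamma> k * y k)"
      using major[OF \<gamma>(2,1)] by (simp add: mult.commute)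
    also have "\<dots> = (\<Sum>j\<in>UNIV. \<bar>c j\<bar> * v j)"
      unfolding \<gamma>_eq v_def sum_distrib_left sum_distrib_right
      by (subst sum.swap) (simp add: mult_ac)
    finally have cx: "(\<Sum>j\<in>UNIV. c j * x j) \<le> (\<Sum>j\<in>UNIV. \<bar>c j\<bar> * v j)" .
    \<comment> \<open>this point of the hull attains \<open>\<Sum> \<gamma>\<^sub>j y\<^sub>j\<close>;
        the signs \<open>\<epsilon>\<close> turn \<open>c\<close> into its modulus\<close>
    define A where "A = P ** real_diag y ** (adjoint_mat P ** real_diag \<epsilon>)"
    have "diagonal_part A \<in> K"
    proof -
      have "unitary_mat (adjoint_mat P ** real_diag \<epsilon>)"
        using P by (intro unitary_mult unitary_adjoint unitary_real_diag_sign) (auto simp: \<epsilon>_def)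
      then have "f (P, adjoint_mat P ** real_diag \<epsilon>) \<in> f ` (?\<U> \<times> ?\<U>)"
        using P by (intro imageI) simp
      then show ?thesis
        unfolding K_def A_def f_def by (simp add: hull_inc)
    qed
    then have "b < a \<bullet> diagonal_part A"
      by (rule ab(2))
    also have "\<dots> = (\<Sum>j\<in>UNIV. - c j * (v j * \<epsilon> j))"
    proof (rule inner_diag)
      fix j
      have "A = (P ** real_diag y ** adjoint_mat P) ** real_diag \<epsilon>"
        by (simp add: A_def matrix_mul_assoc)
      then show "A $ j $ j = complex_of_real (v j * \<epsilon> j)"
        using conj_diag_nth[of "adjoint_mat P" y j] by (simp add: real_diag_mult_right v_def)
    qed
    also have "\<dots> = - (\<Sum>j\<in>UNIV. \<bar>c j\<bar> * v j)"
      unfolding sum_negf[symmetric] by (rule sum.cong) (auto simp: \<epsilon>_def)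
    also have "\<dots> \<le> - (\<Sum>j\<in>UNIV. c j * x j)"
      using cx by simp
    also have "\<dots> = a \<bullet> diagonal_part (real_diag x)"
      using inner_diag[of "real_diag x" x] by (simp add: real_diag_def sum_negf)
    also have "diagonal_part (real_diag x) = (real_diag x :: complex ^ 'n ^ 'n)"
      by (simp add: diagonal_part_def real_diag_def vec_eq_iff)
    finally show False
      using ab(1) by simp
  qed
  moreover have "K \<subseteq> {A. N A \<le> N (real_diag y)}"
    unfolding K_def
  proof (rule hull_minimal)
    show "f ` (?\<U> \<times> ?\<U>) \<subseteq> {A. N A \<le> N (real_diag y)}"
    proof clarsimp
      fix U V :: "complex ^ 'n ^ 'n"
      assume "unitary_mat U" "unitary_mat V"
      then show "N (f (U, V)) \<le> N (real_diag y)"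
        using symmetric_norm_diagonal_part_le[OF N, of "U ** real_diag y ** V"]
        by (simp add: f_def symmetric_norm_unitary[OF N])
    qed
  qed (rule convex_symmetric_norm_ball[OF N])
  ultimately show ?thesis by auto
qed

section \<open>The norm inequality\<close>

theorem theorem1p1:
  fixes A Z :: "nat \<Rightarrow> complex ^ 'n ^ 'n"
    and N :: "complex ^ 'n ^ 'n \<Rightarrow> real"
    and m :: nat and p :: real
  assumes "m \<ge> 1"
    and "\<And>i. i \<in> {1..m} \<Longrightarrow> psd (A i)"
    and "\<And>i. i \<in> {1..m} \<Longrightarrow> expansive (Z i)"
    and "symmetric_norm N"
    and "p > 1"
  shows "N (\<Sum>i=1..m. adjoint_mat (Z i) ** mat_powr (A i) p ** Z i)
       \<le> N (mat_powr (\<Sum>i=1..m. adjoint_mat (Z i) ** A i ** Z i) p)"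
proof -
  note N = \<open>symmetric_norm N\<close> and p = \<open>p > 1\<close>
  obtain e :: "'n \<Rightarrow> nat" where e: "bij_betw e UNIV {..<CARD('n)}"
    using ex_bij_betw_finite_nat[OF finite, of "UNIV :: 'n set"] by (auto simp: lessThan_atLeast0)
  have inj: "inj e"
    using e by (rule bij_betw_imp_inj_on)
  have "\<exists>U a. unitary_mat U \<and> (\<forall>k. 0 \<le> a k) \<and> A i = U ** real_diag a ** adjoint_mat U"
    if "i \<in> {1..m}" for i
    using psd_spectral_sorted[OF inj assms(2)[OF that]] by metis
  then obtain U a where U: "\<And>i. i \<in> {1..m} \<Longrightarrow> unitary_mat (U i)"
    and a: "\<And>i k. i \<in> {1..m} \<Longrightarrow> 0 \<le> a i k"
    and A: "\<And>i. i \<in> {1..m} \<Longrightarrow> A i = U i ** real_diag (a i) ** adjoint_mat (U i)"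
    by metis
  define X where "X = (\<Sum>i=1..m. adjoint_mat (Z i) ** mat_powr (A i) p ** Z i)"
  define S where "S = (\<Sum>i=1..m. adjoint_mat (Z i) ** A i ** Z i)"
  have Ap: "mat_powr (A i) p = U i ** real_diag (\<lambda>k. a i k powr p) ** adjoint_mat (U i)"
    if "i \<in> {1..m}" for i
    unfolding mat_powr_def A[OF that] by (rule mat_fun_unitary_diag[OF U[OF that]])
  have "psd X"
    unfolding X_def
  proof (intro psd_sum psd_conj)
    fix i assume i: "i \<in> {1..m}"
    have "psd (adjoint_mat (adjoint_mat (U i)) ** real_diag (\<lambda>k. a i k powr p) ** adjoint_mat (U i))"
      by (intro psd_conj psd_real_diag) simp
    then show "psd (mat_powr (A i) p)"
      by (simp add: Ap[OF i])
  qed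
  then obtain V x where V: "unitary_mat V" and x: "decreasing_along e x" "\<And>i. 0 \<le> x i"
    and X: "X = V ** real_diag x ** adjoint_mat V"
    using psd_spectral_sorted[OF inj] by metis
  have "psd S"
    unfolding S_def using assms(2) by (intro psd_sum psd_conj)
  then obtain W s where W: "unitary_mat W" and s: "decreasing_along e s" "\<And>i. 0 \<le> s i"
    and S: "S = W ** real_diag s ** adjoint_mat W"
    using psd_spectral_sorted[OF inj] by metis
  \<comment> \<open>the eigenvalues of \<open>X\<close> to the power \<open>1/p\<close> are weakly
      majorized by those of \<open>S\<close>\<close>
  have major: "(\<Sum>j\<in>UNIV. w j * x j powr (1 / p)) \<le> (\<Sum>j\<in>UNIV. w j * s j)"
    if w: "\<And>i. 0 \<le> w i" "decreasing_along e w" for w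
  proof -
    have "(\<Sum>j\<in>UNIV. w j * x j powr (1 / p))
        \<le> weighted_trace w (adjoint_mat V ** (\<Sum>i=1..m. adjoint_mat (Z i)
            ** (U i ** real_diag (\<lambda>k. (a i k powr p) powr (1 / p)) ** adjoint_mat (U i)) ** Z i) ** V)"
    proof (rule weighted_trace_powr_compression)
      show "(\<Sum>i=1..m. adjoint_mat (Z i)
          ** (U i ** real_diag (\<lambda>k. a i k powr p) ** adjoint_mat (U i)) ** Z i)
          = V ** real_diag x ** adjoint_mat V"
        unfolding X[symmetric] X_def by (simp add: Ap)
    qed (use p U V assms(3) x w in auto)
    also have "(\<Sum>i=1..m. adjoint_mat (Z i)
        ** (U i ** real_diag (\<lambda>k. (a i k powr p) powr (1 / p)) ** adjoint_mat (U i)) ** Z i) = S"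
      unfolding S_def using p a by (intro sum.cong) (simp_all add: A powr_powr)
    also have "adjoint_mat V ** S ** V
        = adjoint_mat (adjoint_mat W ** V) ** real_diag s ** (adjoint_mat W ** V)"
      by (simp add: S adjoint_mult matrix_mul_assoc)
    also have "weighted_trace w \<dots>
        = (\<Sum>j\<in>UNIV. w j * (\<Sum>k\<in>UNIV. (cmod ((adjoint_mat W ** V) $ k $ j))\<^sup>2 * s k))"
      unfolding weighted_trace_conj_diag by (simp add: sum_distrib_left mult_ac)
    also have "\<dots> \<le> (\<Sum>j\<in>UNIV. w j * s j)"
    proof -
      have "unitary_mat (adjoint_mat W ** V)"
        using V W by (intro unitary_mult unitary_adjoint)
      then show ?thesis
        by (intro doubly_stochastic_rearrangement[OF e])
           (use w s in \<open>simp_all add: sum_row_unitary sum_column_unitary\<close>)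
    qed
    finally show ?thesis .
  qed
  have "N X = N (real_diag x)"
    unfolding X using V by (simp add: symmetric_norm_unitary[OF N] unitary_adjoint)
  also have "\<dots> \<le> N (real_diag (\<lambda>i. s i powr p))"
    using weak_majorization_powr[OF p x(2,1) s(2) _ _ major] x
    by (intro symmetric_norm_weak_majorization[OF N e]) blast+
  also have "\<dots> = N (mat_powr S p)"
    unfolding S mat_powr_def mat_fun_unitary_diag[OF W]
    using W by (simp add: symmetric_norm_unitary[OF N] unitary_adjoint)
  finally show ?thesis
    unfolding X_def S_def .
qed

end
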